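(* Let $q\ge 2$ be an integer and $f\in L^\infty(\mathbb{T})$. Then the operator $\Gamma_q[f]$ on $\ell^2(T_q)$ is Fredholm if and only if it is invertible. Moreover, $\Gamma_q[f]$ is invertible if and only if $T(f)$ is invertible on $\ell^2(\mathbb{N})$.
   Context: $T_q$ denotes the (vertex set of the) infinite rooted $q$-homogeneous tree: there is a root $o$, and each vertex has exactly $q$ children. $d$ is the graph distance and $|\sigma| := d(o,\sigma)$. Write $\sigma_1\preccurlyeq\sigma_2$ if $\sigma_1,\sigma_2$ lie on a common geodesic ray starting at the root and $|\sigma_1|\le|\sigma_2|$. Let $\mathcal{C}\subset T_q\times T_q$ be the set of comparable pairs ($\sigma_1\preccurlyeq\sigma_2$ or $\sigma_2\preccurlyeq\sigma_1$), with indicator function $\mathbf{1}_{\mathcal{C}}$. $\mathbb{T}=\mathbb{R}/2\pi\mathbb{Z}$, $\mathbb{N}=\{0,1,2,\dots\}$. For $f\in L^\infty(\mathbb{T})$, $\widehat f(n)=\int_{\mathbb{T}} f(e^{i\theta})e^{-in\theta}\frac{d\theta}{2\pi}$, and $$\Gamma_q[f](\sigma_1,\sigma_2) := q^{-d(\sigma_1,\sigma_2)/2}\,\widehat f(|\sigma_1|-|\sigma_2|)\,\mathbf{1}_{\mathcal{C}}(\sigma_1,\sigma_2).$$ Bounded operators $A$ on $\ell^2(T_q)$ are identified with their kernels $A(\sigma_1,\sigma_2)=\langle A\delta_{\sigma_2},\delta_{\sigma_1}\rangle$; for every $f\in L^\infty(\mathbb{T})$ the kernel $\Gamma_q[f]$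 represents a bounded operator on $\ell^2(T_q)$. $T(f)$ is the bounded operator on $\ell^2(\mathbb{N})$ with matrix $[\widehat f(k-l)]_{k,l\in\mathbb{N}}$. *)

theory Defs
  imports "HOL-Analysis.Analysis" "HOL-Library.Function_Algebras"
begin

section \<open>The Hilbert space of square-summable functions on an index set\<close>

text \<open>
  Functions on \<open>S\<close> are total functions that vanish outside \<open>S\<close>, so that equality of elements
  of \<open>\<ell>\<^sup>2(S)\<close> is equality of functions.
\<close>

definition ell2 :: "'a set \<Rightarrow> ('a \<Rightarrow> complex) set" where
  "ell2 S = {u. (\<forall>x. x \<notin> S \<longrightarrow> u x = 0) \<and> (\<lambda>x. (cmod (u x))\<^sup>2) summable_on S}"

definition ell2_inner :: "'a set \<Rightarrow> ('a \<Rightarrow> complex) \<Rightarrow> ('a \<Rightarrow> complex) \<Rightarrow> complex" where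
  "ell2_inner S u v = (\<Sum>\<^sub>\<infinity>x\<in>S. u x * cnj (v x))"

definition ell2_norm :: "'a set \<Rightarrow> ('a \<Rightarrow> complex) \<Rightarrow> real" where
  "ell2_norm S u = sqrt (\<Sum>\<^sub>\<infinity>x\<in>S. (cmod (u x))\<^sup>2)"

definition ell2_dist :: "'a set \<Rightarrow> ('a \<Rightarrow> complex) \<Rightarrow> ('a \<Rightarrow> complex) \<Rightarrow> real" where
  "ell2_dist S u v = ell2_norm S (u - v)"

definition cfun_scale :: "complex \<Rightarrow> ('a \<Rightarrow> complex) \<Rightarrow> 'a \<Rightarrow> complex" where
  "cfun_scale c u = (\<lambda>x. c * u x)"

global_interpretation cfun: vector_space cfun_scale
  defines cfun_span = cfun.span
  by unfold_locales (auto simp: cfun_scale_def fun_eq_iff algebra_simps)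

lemma ell2_triangle_aux:
  assumes "u \<in> ell2 S" "v \<in> ell2 S"
  shows "u + v \<in> ell2 S" and "ell2_norm S (u + v) \<le> ell2_norm S u + ell2_norm S v"
proof -
  have su: "(\<lambda>x. (cmod (u x))\<^sup>2) summable_on S" and sv: "(\<lambda>x. (cmod (v x))\<^sup>2) summable_on S"
    using assms by (auto simp: ell2_def)
  let ?N = "ell2_norm S u + ell2_norm S v"
  have N0: "0 \<le> ?N"
    by (auto simp: ell2_norm_def intro!: add_nonneg_nonneg real_sqrt_ge_zero infsum_nonneg)
  have fin: "(\<Sum>x\<in>F. (cmod (u x + v x))\<^sup>2) \<le> ?N\<^sup>2" if F: "finite F" "F \<subseteq> S" for F
  proof -
    have "L2_set (\<lambda>x. cmod (u x + v x)) F \<le> L2_set (\<lambda>x. cmod (u x) + cmod (v x)) F"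
      by (rule L2_set_mono) (auto intro: norm_triangle_ineq)
    also have "\<dots> \<le> L2_set (\<lambda>x. cmod (u x)) F + L2_set (\<lambda>x. cmod (v x)) F"
      by (rule L2_set_triangle_ineq)
    also have "\<dots> \<le> ?N"
      unfolding L2_set_def ell2_norm_def
      by (intro add_mono real_sqrt_le_mono finite_sum_le_infsum su sv F) auto
    finally have "L2_set (\<lambda>x. cmod (u x + v x)) F \<le> ?N" .
    then have "(L2_set (\<lambda>x. cmod (u x + v x)) F)\<^sup>2 \<le> ?N\<^sup>2"
      by (rule power_mono) (rule L2_set_nonneg)
    then show ?thesis
      by (simp add: L2_set_def sum_nonneg)
  qed
  have s: "(\<lambda>x. (cmod (u x + v x))\<^sup>2) summable_on S"
    by (rule nonneg_bdd_above_summable_on) (use fin in \<open>auto intro!: bdd_aboveI2\<close>)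
  then show "u + v \<in> ell2 S"
    using assms by (auto simp: ell2_def)
  have "(\<Sum>\<^sub>\<infinity>x\<in>S. (cmod (u x + v x))\<^sup>2) \<le> ?N\<^sup>2"
    by (rule infsum_le_finite_sums[OF s]) (use fin in auto)
  then show "ell2_norm S (u + v) \<le> ?N"
    using N0 by (simp add: ell2_norm_def real_le_lsqrt)
qed

lemma ell2_uminus: "u \<in> ell2 S \<Longrightarrow> - u \<in> ell2 S"
  by (auto simp: ell2_def)

lemma Metric_space_ell2: "Metric_space (ell2 S) (ell2_dist S)"
proof
  fix u v w :: "'a \<Rightarrow> complex"
  show "0 \<le> ell2_dist S u v"
    by (auto simp: ell2_dist_def ell2_norm_def intro!: real_sqrt_ge_zero infsum_nonneg)
  show "ell2_dist S u v = ell2_dist S v u"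
    by (simp add: ell2_dist_def ell2_norm_def norm_minus_commute)
  have diff: "a - b \<in> ell2 S" if "a \<in> ell2 S" "b \<in> ell2 S" for a b
    using ell2_triangle_aux(1)[OF that(1) ell2_uminus[OF that(2)]] by simp
  show "ell2_dist S u v = 0 \<longleftrightarrow> u = v" if "u \<in> ell2 S" "v \<in> ell2 S"
  proof
    assume "ell2_dist S u v = 0"
    then have z: "(\<Sum>\<^sub>\<infinity>x\<in>S. (cmod (u x - v x))\<^sup>2) = 0"
      by (simp add: ell2_dist_def ell2_norm_def)
    have "(cmod (u x - v x))\<^sup>2 = 0" if "x \<in> S" for x
      by (rule nonneg_infsum_le_0D[where A = S])
        (use z diff[OF \<open>u \<in> ell2 S\<close> \<open>v \<in> ell2 S\<close>] that in \<open>auto simp: ell2_def\<close>)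
    with that show "u = v"
      by (fastforce simp: ell2_def fun_eq_iff)
  qed (simp add: ell2_dist_def ell2_norm_def)
  show "ell2_dist S u w \<le> ell2_dist S u v + ell2_dist S v w"
    if "u \<in> ell2 S" "v \<in> ell2 S" "w \<in> ell2 S"
    using ell2_triangle_aux(2)[OF diff[OF that(1,2)] diff[OF that(2,3)]]
    by (simp add: ell2_dist_def)
qed


section \<open>Bounded, invertible and Fredholm operators\<close>

text \<open>
  Operators are extensional on \<open>\<ell>\<^sup>2(S)\<close>, so that a bounded operator is
  uniquely determined by its kernel.
\<close>

definition bounded_operator :: "'a set \<Rightarrow> (('a \<Rightarrow> complex) \<Rightarrow> ('a \<Rightarrow> complex)) \<Rightarrow> bool" where
  "bounded_operator S A \<longleftrightarrow>
     A \<in> ell2 S \<rightarrow>\<^sub>E ell2 S \<and>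
     (\<forall>u\<in>ell2 S. \<forall>v\<in>ell2 S. A (u + v) = A u + A v) \<and>
     (\<forall>c. \<forall>u\<in>ell2 S. A (cfun_scale c u) = cfun_scale c (A u)) \<and>
     (\<exists>C. \<forall>u\<in>ell2 S. ell2_norm S (A u) \<le> C * ell2_norm S u)"

definition invertible_operator :: "'a set \<Rightarrow> (('a \<Rightarrow> complex) \<Rightarrow> ('a \<Rightarrow> complex)) \<Rightarrow> bool" where
  "invertible_operator S A \<longleftrightarrow>
     bounded_operator S A \<and>
     (\<exists>B. bounded_operator S B \<and> (\<forall>u\<in>ell2 S. A (B u) = u \<and> B (A u) = u))"

text \<open>Finite-dimensional null space, closed range, and range of finite codimension.\<close>

definition fredholm_operator :: "'a set \<Rightarrow> (('a \<Rightarrow> complex) \<Rightarrow> ('a \<Rightarrow> complex)) \<Rightarrow> bool" where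
  "fredholm_operator S A \<longleftrightarrow>
     bounded_operator S A \<and>
     (\<exists>F. finite F \<and> {u \<in> ell2 S. A u = 0} = cfun_span F) \<and>
     closedin (Metric_space.mtopology (ell2 S) (ell2_dist S)) (A ` ell2 S) \<and>
     (\<exists>F. finite F \<and> F \<subseteq> ell2 S \<and> ell2 S = {v + w | v w. v \<in> A ` ell2 S \<and> w \<in> cfun_span F})"

definition has_kernel ::
    "'a set \<Rightarrow> (('a \<Rightarrow> complex) \<Rightarrow> ('a \<Rightarrow> complex)) \<Rightarrow> ('a \<Rightarrow> 'a \<Rightarrow> complex) \<Rightarrow> bool" where
  "has_kernel S A K \<longleftrightarrow>
     (\<forall>x\<in>S. \<forall>y\<in>S. ell2_inner S (A (indicator {y})) (indicator {x}) = K x y)"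

definition kernel_operator ::
    "'a set \<Rightarrow> ('a \<Rightarrow> 'a \<Rightarrow> complex) \<Rightarrow> (('a \<Rightarrow> complex) \<Rightarrow> ('a \<Rightarrow> complex))" where
  "kernel_operator S K = (THE A. bounded_operator S A \<and> has_kernel S A K)"


section \<open>Essentially bounded functions on the circle and Toeplitz operators\<close>

text \<open>
  Functions on the circle are given by their values at the points \<open>e\<^sup>i\<^sup>\<theta>\<close>. Elements of
  \<open>L\<^sup>\<infinity>\<close> are represented by functions rather than by classes modulo null sets; the values
  off the unit circle are irrelevant.
\<close>

definition Linf_circle :: "(complex \<Rightarrow> complex) set" where
  "Linf_circle =
     {f. (\<lambda>\<theta>. f (cis \<theta>)) \<in> borel_measurable (lebesgue_on {0..2*pi}) \<and>
         (\<exists>C. AE \<theta> in lebesgue_on {0..2*pi}. cmod (f (cis \<theta>)) \<le> C)}"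

definition fourier_coeff :: "(complex \<Rightarrow> complex) \<Rightarrow> int \<Rightarrow> complex" where
  "fourier_coeff f n =
     (LINT \<theta>|lebesgue_on {0..2*pi}. f (cis \<theta>) * exp (- \<i> * of_int n * of_real \<theta>)) / (2 * of_real pi)"

definition toeplitz_operator :: "(complex \<Rightarrow> complex) \<Rightarrow> ((nat \<Rightarrow> complex) \<Rightarrow> (nat \<Rightarrow> complex))" where
  "toeplitz_operator f = kernel_operator UNIV (\<lambda>k l. fourier_coeff f (int k - int l))"


section \<open>The rooted homogeneous tree\<close>

text \<open>
  A vertex is the word of child labels along the path from the root \<open>[]\<close>; the children of
  \<open>\<sigma>\<close> are the words \<open>\<sigma> @ [i]\<close> with \<open>i < q\<close>.
\<close>

definition tree :: "nat \<Rightarrow> nat list set" where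
  "tree q = lists {..<q}"

definition tree_edges :: "nat \<Rightarrow> (nat list \<times> nat list) set" where
  "tree_edges q =
     {(\<sigma>, \<sigma> @ [i]) | \<sigma> i. \<sigma> \<in> tree q \<and> i < q} \<union> {(\<sigma> @ [i], \<sigma>) | \<sigma> i. \<sigma> \<in> tree q \<and> i < q}"

definition tree_dist :: "nat \<Rightarrow> nat list \<Rightarrow> nat list \<Rightarrow> nat" where
  "tree_dist q \<sigma> \<tau> = (LEAST n. (\<sigma>, \<tau>) \<in> tree_edges q ^^ n)"

definition tree_level :: "nat \<Rightarrow> nat list \<Rightarrow> nat" where
  "tree_level q \<sigma> = tree_dist q [] \<sigma>"

definition root_geodesic_ray :: "nat \<Rightarrow> (nat \<Rightarrow> nat list) \<Rightarrow> bool" where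
  "root_geodesic_ray q r \<longleftrightarrow>
     range r \<subseteq> tree q \<and> r 0 = [] \<and>
     (\<forall>m n. int (tree_dist q (r m) (r n)) = \<bar>int m - int n\<bar>)"

definition tree_le :: "nat \<Rightarrow> nat list \<Rightarrow> nat list \<Rightarrow> bool" where
  "tree_le q \<sigma> \<tau> \<longleftrightarrow>
     (\<exists>r. root_geodesic_ray q r \<and> \<sigma> \<in> range r \<and> \<tau> \<in> range r) \<and> tree_level q \<sigma> \<le> tree_level q \<tau>"

definition comparable_pairs :: "nat \<Rightarrow> (nat list \<times> nat list) set" where
  "comparable_pairs q =
     {(\<sigma>, \<tau>). \<sigma> \<in> tree q \<and> \<tau> \<in> tree q \<and> (tree_le q \<sigma> \<tau> \<or> tree_le q \<tau> \<sigma>)}"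

definition tree_toeplitz_kernel ::
    "nat \<Rightarrow> (complex \<Rightarrow> complex) \<Rightarrow> nat list \<Rightarrow> nat list \<Rightarrow> complex" where
  "tree_toeplitz_kernel q f \<sigma> \<tau> =
     of_real (real q powr (- real (tree_dist q \<sigma> \<tau>) / 2)) *
     fourier_coeff f (int (tree_level q \<sigma>) - int (tree_level q \<tau>)) *
     indicator (comparable_pairs q) (\<sigma>, \<tau>)"

definition tree_toeplitz_operator ::
    "nat \<Rightarrow> (complex \<Rightarrow> complex) \<Rightarrow> ((nat list \<Rightarrow> complex) \<Rightarrow> (nat list \<Rightarrow> complex))" where
  "tree_toeplitz_operator q f = kernel_operator (tree q) (tree_toeplitz_kernel q f)"

end

theory Submission
  imports Defs
begin

text \<open>
  Let \<open>V\<close> be the isometry of \<open>\<ell>\<^sup>2(T\<^sub>q)\<close> that sends the basis vector of a vertex to \<open>1 / sqrt q\<close> times the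
  sum of the basis vectors of its \<open>q\<close> children. The operator with kernel \<open>\<Gamma>\<^sub>q[f]\<close> is the Toeplitz
  operator built from \<open>V\<close> in place of the unilateral shift: powers of \<open>V\<close> with the Fourier coefficients
  of nonnegative index, powers of its adjoint with the others. Since \<open>V\<close> raises levels, it is a pure
  isometry, so by the Wold decomposition it is an orthogonal sum of copies of the unilateral shift, one
  for each vector of an orthonormal basis of the kernel of the adjoint of \<open>V\<close>. For \<open>q \<ge> 2\<close> this kernel
  is infinite-dimensional, because it contains the functions on the children of a vertex that have sum
  zero. Hence \<open>\<Gamma>\<^sub>q[f]\<close> is unitarily equivalent to the sum of infinitely many copies of \<open>T(f)\<close>.

  Such a sum is invertible if \<open>T(f)\<close> is (\<open>invertible_ampliation\<close>). If it is Fredholm, then \<open>T(f)\<close> is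
  injective, since otherwise the sum would have an infinite-dimensional kernel; it is onto, since
  otherwise the range of the sum would have infinite codimension; and it is bounded below, since
  otherwise the range of the sum would not be closed. So \<open>T(f)\<close> is invertible
  (\<open>fredholm_ampliation_imp_invertible\<close>). As invertible operators are Fredholm, the three properties
  in question imply each other in a circle.

  The decomposition is made explicit by the tensor powers of the Hartley matrix, which act on the
  levels of the tree and turn \<open>V\<close> into the map that appends the letter \<open>0\<close> to a word
  (\<open>infinite_ell2_decomposition_tree\<close>). With its help the kernel of the sum of the copies of \<open>T(f)\<close> is
  computed and found to be \<open>\<Gamma>\<^sub>q[f]\<close> (\<open>tree_toeplitz_operator_eq_ampliation\<close>). That \<open>T(f)\<close> is a bounded
  operator follows from Bessel's inequality.
\<close>


section \<open>Square-summable functions and bounded operators\<close>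

lemma ell2_norm_nonneg [simp]: "0 \<le> ell2_norm S u"
  by (auto simp: ell2_norm_def intro!: infsum_nonneg)

lemma ell2_norm_power2: "(ell2_norm S u)\<^sup>2 = (\<Sum>\<^sub>\<infinity>x\<in>S. (cmod (u x))\<^sup>2)"
  by (simp add: ell2_norm_def infsum_nonneg)

lemma ell2_has_sum:
  assumes "u \<in> ell2 S"
  shows "((\<lambda>x. (cmod (u x))\<^sup>2) has_sum (ell2_norm S u)\<^sup>2) S"
  using assms by (simp add: ell2_norm_power2 ell2_def)

lemma ell2I_has_sum:
  assumes "\<And>x. x \<notin> S \<Longrightarrow> u x = 0" and "((\<lambda>x. (cmod (u x))\<^sup>2) has_sum s) S"
  shows "u \<in> ell2 S" and "(ell2_norm S u)\<^sup>2 = s"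
  using assms by (auto simp: ell2_def ell2_norm_power2 infsumI has_sum_imp_summable)

lemma ell2_outside: "u \<in> ell2 S \<Longrightarrow> x \<notin> S \<Longrightarrow> u x = 0"
  by (simp add: ell2_def)

lemma ell2_sum_le:
  assumes "u \<in> ell2 S" "finite F" "F \<subseteq> S"
  shows "(\<Sum>x\<in>F. (cmod (u x))\<^sup>2) \<le> (ell2_norm S u)\<^sup>2"
  unfolding ell2_norm_power2
  by (rule finite_sum_le_infsum) (use assms in \<open>auto simp: ell2_def\<close>)

lemma ell2_norm_ge_cmod:
  assumes "u \<in> ell2 S"
  shows "cmod (u x) \<le> ell2_norm S u"
proof (cases "x \<in> S")
  case True
  then have "(cmod (u x))\<^sup>2 \<le> (ell2_norm S u)\<^sup>2"
    using ell2_sum_le[OF assms, of "{x}"] by simp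
  then show ?thesis
    by (rule power2_le_imp_le) simp
qed (use assms in \<open>simp add: ell2_outside\<close>)

lemma ell2I_bound:
  assumes "\<And>x. x \<notin> S \<Longrightarrow> u x = 0" and "0 \<le> b"
    and "\<And>F. finite F \<Longrightarrow> F \<subseteq> S \<Longrightarrow> (\<Sum>x\<in>F. (cmod (u x))\<^sup>2) \<le> b\<^sup>2"
  shows "u \<in> ell2 S" and "ell2_norm S u \<le> b"
proof -
  have s: "(\<lambda>x. (cmod (u x))\<^sup>2) summable_on S"
    by (rule nonneg_bdd_above_summable_on) (use assms(3) in \<open>auto intro!: bdd_aboveI2\<close>)
  then show "u \<in> ell2 S"
    using assms(1) by (simp add: ell2_def)
  have "(ell2_norm S u)\<^sup>2 \<le> b\<^sup>2"
    unfolding ell2_norm_power2 by (rule infsum_le_finite_sums[OF s]) (use assms(3) in auto)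
  then show "ell2_norm S u \<le> b"
    by (rule power2_le_imp_le) fact
qed

lemma ell2_zero [simp]: "0 \<in> ell2 S" "ell2_norm S 0 = 0"
  by (auto simp: ell2_def ell2_norm_def)

lemma ell2_norm_eq_0D:
  assumes "u \<in> ell2 S" "ell2_norm S u = 0"
  shows "u = 0"
  using ell2_norm_ge_cmod[OF assms(1)] assms(2) by (auto simp: fun_eq_iff)

lemma ell2_scale:
  assumes "u \<in> ell2 S"
  shows "cfun_scale c u \<in> ell2 S" and "ell2_norm S (cfun_scale c u) = cmod c * ell2_norm S u"
proof -
  have *: "((\<lambda>x. (cmod (cfun_scale c u x))\<^sup>2) has_sum (cmod c)\<^sup>2 * (ell2_norm S u)\<^sup>2) S"
    using has_sum_cmult_right[OF ell2_has_sum[OF assms], of "(cmod c)\<^sup>2"]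
    by (simp add: cfun_scale_def norm_mult power_mult_distrib)
  have z: "cfun_scale c u x = 0" if "x \<notin> S" for x
    using ell2_outside[OF assms that] by (simp add: cfun_scale_def)
  show "cfun_scale c u \<in> ell2 S"
    by (rule ell2I_has_sum(1)[OF z *])
  have "(ell2_norm S (cfun_scale c u))\<^sup>2 = (cmod c * ell2_norm S u)\<^sup>2"
    using ell2I_has_sum(2)[OF z *] by (simp add: power_mult_distrib)
  then show "ell2_norm S (cfun_scale c u) = cmod c * ell2_norm S u"
    by (simp add: power2_eq_iff_nonneg)
qed

lemma ell2_add: "u \<in> ell2 S \<Longrightarrow> v \<in> ell2 S \<Longrightarrow> u + v \<in> ell2 S"
  by (rule ell2_triangle_aux)

lemma diff_eq_add_scale: "u - v = u + cfun_scale (- 1) v"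
  by (simp add: fun_eq_iff cfun_scale_def)

lemma ell2_diff: "u \<in> ell2 S \<Longrightarrow> v \<in> ell2 S \<Longrightarrow> u - v \<in> ell2 S"
  unfolding diff_eq_add_scale by (intro ell2_add ell2_scale)

lemma ell2_norm_triangle_diff:
  assumes "u \<in> ell2 S" "v \<in> ell2 S"
  shows "ell2_norm S (u - v) \<le> ell2_norm S u + ell2_norm S v"
proof -
  have "ell2_norm S (u + - v) \<le> ell2_norm S u + ell2_norm S (- v)"
    by (intro ell2_triangle_aux ell2_uminus assms)
  then show ?thesis
    by (simp add: ell2_norm_def)
qed

lemma ell2_sum:
  assumes "\<And>i. i \<in> I \<Longrightarrow> u i \<in> ell2 S"
  shows "(\<Sum>i\<in>I. u i) \<in> ell2 S"
  using assms by (induction I rule: infinite_finite_induct) (auto intro: ell2_add)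

lemma sum_fun_apply: "(\<Sum>i\<in>I. u i) x = (\<Sum>i\<in>I. u i x)"
  by (induction I rule: infinite_finite_induct) auto

lemma ell2_finite_support:
  assumes "finite D" "D \<subseteq> S" "\<And>x. x \<notin> D \<Longrightarrow> u x = 0"
  shows "u \<in> ell2 S"
proof (rule ell2I_has_sum(1))
  show "((\<lambda>x. (cmod (u x))\<^sup>2) has_sum (\<Sum>x\<in>D. (cmod (u x))\<^sup>2)) S"
    by (rule has_sum_finite_neutralI) (use assms in auto)
qed (use assms in auto)

lemma indicator_ell2: "y \<in> S \<Longrightarrow> indicator {y} \<in> ell2 S"
  by (rule ell2_finite_support[of "{y}"]) auto

lemma ell2_inner_indicator:
  assumes "x \<in> S"
  shows "ell2_inner S w (indicator {x}) = w x"
proof -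
  have "((\<lambda>y. w y * cnj (indicator {x} y)) has_sum (\<Sum>y\<in>{x}. w y * cnj (indicator {x} y))) S"
    by (rule has_sum_finite_neutralI[OF _ _ _ refl]) (use assms in auto)
  then show ?thesis
    by (simp add: ell2_inner_def infsumI)
qed

lemma bounded_operatorD:
  assumes "bounded_operator S A"
  shows "u \<in> ell2 S \<Longrightarrow> A u \<in> ell2 S"
    and "u \<in> ell2 S \<Longrightarrow> v \<in> ell2 S \<Longrightarrow> A (u + v) = A u + A v"
    and "u \<in> ell2 S \<Longrightarrow> A (cfun_scale c u) = cfun_scale c (A u)"
    and "u \<notin> ell2 S \<Longrightarrow> A u = undefined"
  using assms unfolding bounded_operator_def by (auto simp: PiE_iff extensional_def)

lemma bounded_operator_bound:
  assumes "bounded_operator S A"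
  obtains K where "0 \<le> K" "\<And>u. u \<in> ell2 S \<Longrightarrow> ell2_norm S (A u) \<le> K * ell2_norm S u"
proof -
  obtain K where K: "\<And>u. u \<in> ell2 S \<Longrightarrow> ell2_norm S (A u) \<le> K * ell2_norm S u"
    using assms unfolding bounded_operator_def by blast
  have "ell2_norm S (A u) \<le> max 0 K * ell2_norm S u" if "u \<in> ell2 S" for u
    using K[OF that] by (rule order_trans) (simp add: mult_right_mono)
  then show thesis
    by (intro that[of "max 0 K"]) auto
qed

lemma bounded_operator_diff:
  assumes "bounded_operator S A" "u \<in> ell2 S" "v \<in> ell2 S"
  shows "A (u - v) = A u - A v"
  unfolding diff_eq_add_scale
  by (simp only: bounded_operatorD[OF assms(1)] assms(2,3) ell2_scale)

lemma bounded_operator_zero: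
  assumes "bounded_operator S A"
  shows "A 0 = 0"
  using bounded_operator_diff[OF assms ell2_zero(1) ell2_zero(1)] by simp

lemma bounded_operator_sum:
  assumes "bounded_operator S A" "\<And>i. i \<in> I \<Longrightarrow> u i \<in> ell2 S"
  shows "A (\<Sum>i\<in>I. cfun_scale (k i) (u i)) = (\<Sum>i\<in>I. cfun_scale (k i) (A (u i)))"
  using assms(2)
proof (induction I rule: infinite_finite_induct)
  case (insert i I)
  have "A (cfun_scale (k i) (u i) + (\<Sum>i\<in>I. cfun_scale (k i) (u i))) =
      A (cfun_scale (k i) (u i)) + A (\<Sum>i\<in>I. cfun_scale (k i) (u i))"
    using insert.prems by (intro bounded_operatorD(2)[OF assms(1)] ell2_sum ell2_scale) auto
  also have "A (cfun_scale (k i) (u i)) = cfun_scale (k i) (A (u i))"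
    using insert.prems by (intro bounded_operatorD(3)[OF assms(1)]) auto
  also have "A (\<Sum>i\<in>I. cfun_scale (k i) (u i)) = (\<Sum>i\<in>I. cfun_scale (k i) (A (u i)))"
    using insert.prems by (intro insert.IH) auto
  finally show ?case
    unfolding sum.insert[OF insert.hyps(1,2)] .
qed (simp_all add: bounded_operator_zero[OF assms(1)])

lemma bounded_operatorI:
  assumes "\<And>u. u \<in> ell2 S \<Longrightarrow> A u \<in> ell2 S"
    and "\<And>u v. u \<in> ell2 S \<Longrightarrow> v \<in> ell2 S \<Longrightarrow> A (u + v) = A u + A v"
    and "\<And>c u. u \<in> ell2 S \<Longrightarrow> A (cfun_scale c u) = cfun_scale c (A u)"
    and "\<And>u. u \<in> ell2 S \<Longrightarrow> ell2_norm S (A u) \<le> K * ell2_norm S u"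
  shows "bounded_operator S (restrict A (ell2 S))"
  unfolding bounded_operator_def using assms
  by (auto simp: ell2_add ell2_scale intro!: exI[of _ K])

text \<open>
  The finitely supported functions are dense in \<open>\<ell>\<^sup>2\<close>, so a bounded operator is determined by
  its values on the basis vectors, that is, by its kernel.
\<close>

lemma bounded_operator_eqI:
  assumes A: "bounded_operator S A" and A': "bounded_operator S A'"
    and eq: "\<And>y. y \<in> S \<Longrightarrow> A (indicator {y}) = A' (indicator {y})"
  shows "A = A'"
proof
  fix u
  show "A u = A' u"
  proof (cases "u \<in> ell2 S")
    case True
    obtain K where K: "0 \<le> K" "\<And>u. u \<in> ell2 S \<Longrightarrow> ell2_norm S (A u) \<le> K * ell2_norm S u"
      by (rule bounded_operator_bound[OF A]) blast
    obtain K' where K': "0 \<le> K'" "\<And>u. u \<in> ell2 S \<Longrightarrow> ell2_norm S (A' u) \<le> K' * ell2_norm S u"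
      by (rule bounded_operator_bound[OF A']) blast
    have small: "ell2_norm S (A u - A' u) \<le> (K + K') * e" if "0 < e" for e
    proof -
      have "0 < e\<^sup>2"
        using that by simp
      then obtain F where F: "finite F" "F \<subseteq> S"
          and d: "dist (\<Sum>x\<in>F. (cmod (u x))\<^sup>2) ((ell2_norm S u)\<^sup>2) \<le> e\<^sup>2"
        using has_sum_finite_approximation[OF ell2_has_sum[OF True]] by blast
      define w where "w = (\<Sum>y\<in>F. cfun_scale (u y) (indicator {y}))"
      have w_eq: "w x = (if x \<in> F then u x else 0)" for x
      proof -
        have "w x = (\<Sum>y\<in>F. if y = x then u x else 0)"
          unfolding w_def sum_fun_apply by (rule sum.cong) (auto simp: cfun_scale_def)
        then show ?thesis
          using F(1) by simp
      qed
      have w: "w \<in> ell2 S"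
        unfolding w_def by (intro ell2_sum ell2_scale indicator_ell2) (use F in auto)
      have ind: "indicator {y} \<in> ell2 S" if "y \<in> F" for y
        by (rule indicator_ell2) (use that F in auto)
      have "A w = (\<Sum>y\<in>F. cfun_scale (u y) (A (indicator {y})))"
        unfolding w_def by (rule bounded_operator_sum[OF A ind])
      also have "\<dots> = (\<Sum>y\<in>F. cfun_scale (u y) (A' (indicator {y})))"
        using F eq by (intro sum.cong) auto
      also have "\<dots> = A' w"
        unfolding w_def by (rule bounded_operator_sum[OF A' ind, symmetric])
      finally have Aw: "A w = A' w" .
      have "((\<lambda>x. (cmod (u x))\<^sup>2) has_sum ((ell2_norm S u)\<^sup>2 - (\<Sum>x\<in>F. (cmod (u x))\<^sup>2))) (S - F)"
        by (rule has_sum_Diff[OF ell2_has_sum[OF True] has_sum_finite[OF F(1)] F(2)])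
      then have "((\<lambda>x. (cmod ((u - w) x))\<^sup>2) has_sum
          ((ell2_norm S u)\<^sup>2 - (\<Sum>x\<in>F. (cmod (u x))\<^sup>2))) S"
        by (rule iffD1[OF has_sum_cong_neutral, rotated -1]) (auto simp: w_eq)
      then have "(ell2_norm S (u - w))\<^sup>2 = (ell2_norm S u)\<^sup>2 - (\<Sum>x\<in>F. (cmod (u x))\<^sup>2)"
        by (simp add: ell2_norm_power2 infsumI)
      then have "(ell2_norm S (u - w))\<^sup>2 \<le> e\<^sup>2"
        using d by (simp add: dist_real_def abs_le_iff)
      then have ue: "ell2_norm S (u - w) \<le> e"
        by (rule power2_le_imp_le) (use that in simp)
      have uw: "u - w \<in> ell2 S"
        by (rule ell2_diff[OF True w])
      have eq_diff: "A u - A' u = A (u - w) - A' (u - w)"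
        by (simp add: bounded_operator_diff[OF A True w] bounded_operator_diff[OF A' True w] Aw)
      have "ell2_norm S (A u - A' u) \<le> ell2_norm S (A (u - w)) + ell2_norm S (A' (u - w))"
        unfolding eq_diff
        by (rule ell2_norm_triangle_diff[OF bounded_operatorD(1)[OF A uw] bounded_operatorD(1)[OF A' uw]])
      also have "\<dots> \<le> K * ell2_norm S (u - w) + K' * ell2_norm S (u - w)"
        by (intro add_mono K K' uw)
      also have "\<dots> \<le> (K + K') * e"
        using mult_left_mono[OF ue, of "K + K'"] K K' by (simp add: algebra_simps)
      finally show ?thesis .
    qed
    have "ell2_norm S (A u - A' u) \<le> e" if "0 < e" for e
    proof -
      have "0 < K + K' + 1"
        using K K' by simp
      then have "(K + K') * (e / (K + K' + 1)) \<le> e"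
        using that by (simp add: field_simps)
      then show ?thesis
        using small[of "e / (K + K' + 1)"] that \<open>0 < K + K' + 1\<close> by simp
    qed
    then have "ell2_norm S (A u - A' u) \<le> 0"
      by (intro field_le_epsilon[of _ 0]) simp
    then have "ell2_norm S (A u - A' u) = 0"
      by (simp add: antisym)
    then have "A u - A' u = 0"
      by (intro ell2_norm_eq_0D ell2_diff) (auto simp: bounded_operatorD A A' True)
    then show ?thesis
      by simp
  next
    case False
    then show ?thesis
      by (simp add: bounded_operatorD(4)[OF A] bounded_operatorD(4)[OF A'])
  qed
qed

lemma kernel_operator_eqI:
  assumes A: "bounded_operator S A" and K: "has_kernel S A K"
  shows "kernel_operator S K = A"
  unfolding kernel_operator_def
proof (rule the_equality)
  fix A' assume A': "bounded_operator S A' \<and> has_kernel S A' K"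
  show "A' = A"
  proof (rule bounded_operator_eqI[of S])
    fix y assume y: "y \<in> S"
    show "A' (indicator {y}) = A (indicator {y})"
    proof
      fix x
      show "A' (indicator {y}) x = A (indicator {y}) x"
      proof (cases "x \<in> S")
        case True
        then have "A' (indicator {y}) x = K x y" "A (indicator {y}) x = K x y"
          using A' K y by (auto simp: has_kernel_def ell2_inner_indicator)
        then show ?thesis
          by simp
      next
        case False
        then show ?thesis
          using A A' ell2_outside[OF bounded_operatorD(1)[OF _ indicator_ell2[OF y]] False]
          by metis
      qed
    qed
  qed (use A A' in auto)
qed (use A K in auto)

text \<open>
  Turning the phases of \<open>u\<close> so that all products \<open>K x y * u y\<close> become nonnegative does not increase
  the norm of \<open>u\<close>; so the bound on the single row \<open>x\<close> gives the absolute convergence of the series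
  that defines \<open>(A u) x\<close>. The bound on finitely many rows then passes to the limit.
\<close>

lemma kernel_operator_exists:
  fixes K :: "'a \<Rightarrow> 'a \<Rightarrow> complex"
  assumes "0 \<le> b"
    and bound: "\<And>F G u. \<lbrakk>finite F; F \<subseteq> S; finite G; G \<subseteq> S\<rbrakk> \<Longrightarrow>
      (\<Sum>x\<in>F. (cmod (\<Sum>y\<in>G. K x y * u y))\<^sup>2) \<le> b\<^sup>2 * (\<Sum>y\<in>G. (cmod (u y))\<^sup>2)"
  shows "\<exists>A. bounded_operator S A \<and> has_kernel S A K"
proof -
  define A where "A u = (\<lambda>x. if x \<in> S then \<Sum>\<^sub>\<infinity>y\<in>S. K x y * u y else 0)" for u
  have abs_summable: "(\<lambda>y. norm (K x y * u y)) summable_on S" if x: "x \<in> S" and u: "u \<in> ell2 S" for x u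
  proof (rule nonneg_bdd_above_summable_on)
    show "bdd_above (sum (\<lambda>y. norm (K x y * u y)) ` {F. F \<subseteq> S \<and> finite F})"
    proof (rule bdd_aboveI2)
      fix G assume "G \<in> {F. F \<subseteq> S \<and> finite F}"
      then have G: "finite G" "G \<subseteq> S" by auto
      \<comment> \<open>\<open>w\<close> is \<open>u\<close> with the phases turned.\<close>
      define w where "w y = of_real (cmod (u y)) * cnj (sgn (K x y))" for y
      have Kw: "K x y * w y = of_real (norm (K x y * u y))" for y
      proof -
        have "K x y * cnj (sgn (K x y)) = K x y * cnj (K x y) / of_real (cmod (K x y))"
          by (simp add: sgn_eq)
        also have "\<dots> = of_real ((cmod (K x y))\<^sup>2) / of_real (cmod (K x y))"
          by (simp only: complex_norm_square)
        also have "\<dots> = of_real (cmod (K x y))"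
          by (simp add: power2_eq_square)
        finally show ?thesis
          by (simp add: w_def norm_mult mult_ac)
      qed
      have wu: "cmod (w y) \<le> cmod (u y)" for y
        by (simp add: w_def norm_mult norm_sgn)
      have "(\<Sum>y\<in>G. norm (K x y * u y))\<^sup>2 = (cmod (\<Sum>y\<in>G. K x y * w y))\<^sup>2"
        unfolding Kw by (simp flip: of_real_sum)
      also have "\<dots> \<le> b\<^sup>2 * (\<Sum>y\<in>G. (cmod (w y))\<^sup>2)"
        using bound[of "{x}" G w] x G by simp
      also have "\<dots> \<le> b\<^sup>2 * (\<Sum>y\<in>G. (cmod (u y))\<^sup>2)"
        by (intro mult_left_mono sum_mono power_mono wu) auto
      also have "\<dots> \<le> b\<^sup>2 * (ell2_norm S u)\<^sup>2"
        by (intro mult_left_mono ell2_sum_le u G) auto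
      finally have "(\<Sum>y\<in>G. norm (K x y * u y))\<^sup>2 \<le> (b * ell2_norm S u)\<^sup>2"
        by (simp add: power_mult_distrib)
      then show "(\<Sum>y\<in>G. norm (K x y * u y)) \<le> b * ell2_norm S u"
        by (rule power2_le_imp_le) (simp add: \<open>0 \<le> b\<close>)
    qed
  qed auto
  have A_has_sum: "((\<lambda>y. K x y * u y) has_sum A u x) S" if "x \<in> S" "u \<in> ell2 S" for x u
    using abs_summable_summable[OF abs_summable[OF that]] that by (simp add: A_def)
  have A_bound: "(\<Sum>x\<in>F. (cmod (A u x))\<^sup>2) \<le> (b * ell2_norm S u)\<^sup>2"
    if u: "u \<in> ell2 S" and F: "finite F" "F \<subseteq> S" for u F
  proof (rule tendsto_upperbound)
    show "((\<lambda>G. \<Sum>x\<in>F. (cmod (\<Sum>y\<in>G. K x y * u y))\<^sup>2) \<longlongrightarrow> (\<Sum>x\<in>F. (cmod (A u x))\<^sup>2))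
        (finite_subsets_at_top S)"
      by (intro tendsto_intros) (use A_has_sum u F in \<open>auto simp: has_sum_def\<close>)
    show "\<forall>\<^sub>F G in finite_subsets_at_top S.
        (\<Sum>x\<in>F. (cmod (\<Sum>y\<in>G. K x y * u y))\<^sup>2) \<le> (b * ell2_norm S u)\<^sup>2"
    proof (rule eventually_finite_subsets_at_top_weakI)
      fix G assume G: "finite G" "G \<subseteq> S"
      have "(\<Sum>x\<in>F. (cmod (\<Sum>y\<in>G. K x y * u y))\<^sup>2) \<le> b\<^sup>2 * (\<Sum>y\<in>G. (cmod (u y))\<^sup>2)"
        by (rule bound[OF F G])
      also have "\<dots> \<le> b\<^sup>2 * (ell2_norm S u)\<^sup>2"
        by (intro mult_left_mono ell2_sum_le u G) auto
      finally show "(\<Sum>x\<in>F. (cmod (\<Sum>y\<in>G. K x y * u y))\<^sup>2) \<le> (b * ell2_norm S u)\<^sup>2"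
        by (simp add: power_mult_distrib)
    qed
  qed simp
  have A_ell2: "A u \<in> ell2 S" "ell2_norm S (A u) \<le> b * ell2_norm S u" if "u \<in> ell2 S" for u
    by (rule ell2I_bound[where b = "b * ell2_norm S u"];
        use A_bound[OF that] \<open>0 \<le> b\<close> in \<open>simp add: A_def\<close>)+
  have "bounded_operator S (restrict A (ell2 S))"
  proof (rule bounded_operatorI)
    fix u v assume uv: "u \<in> ell2 S" "v \<in> ell2 S"
    show "A (u + v) = A u + A v"
    proof
      fix x
      show "A (u + v) x = (A u + A v) x"
      proof (cases "x \<in> S")
        case True
        have "((\<lambda>y. K x y * (u + v) y) has_sum (A u x + A v x)) S"
          using has_sum_add[OF A_has_sum[OF True uv(1)] A_has_sum[OF True uv(2)]]
          by (simp add: algebra_simps)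
        from has_sum_unique[OF this A_has_sum[OF True ell2_add[OF uv]]] show ?thesis
          by simp
      qed (simp add: A_def)
    qed
  next
    fix c u assume u: "u \<in> ell2 S"
    show "A (cfun_scale c u) = cfun_scale c (A u)"
    proof
      fix x
      show "A (cfun_scale c u) x = cfun_scale c (A u) x"
      proof (cases "x \<in> S")
        case True
        have "((\<lambda>y. K x y * cfun_scale c u y) has_sum c * A u x) S"
          using has_sum_cmult_right[OF A_has_sum[OF True u], of c]
          by (simp add: algebra_simps cfun_scale_def)
        from has_sum_unique[OF this A_has_sum[OF True ell2_scale(1)[OF u]]] show ?thesis
          by (simp add: cfun_scale_def)
      qed (simp add: A_def cfun_scale_def)
    qed
  qed (use A_ell2 in auto)
  moreover have "has_kernel S (restrict A (ell2 S)) K"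
    unfolding has_kernel_def
  proof (intro ballI)
    fix x y assume xy: "x \<in> S" "y \<in> S"
    have "((\<lambda>z. K x z * indicator {y} z) has_sum (\<Sum>z\<in>{y}. K x z * indicator {y} z)) S"
      by (rule has_sum_finite_neutralI[OF _ _ _ refl]) (use xy in auto)
    from has_sum_unique[OF A_has_sum[OF xy(1) indicator_ell2[OF xy(2)]] this]
    show "ell2_inner S (restrict A (ell2 S) (indicator {y})) (indicator {x}) = K x y"
      using xy by (simp add: ell2_inner_indicator indicator_ell2)
  qed
  ultimately show ?thesis
    by blast
qed

text \<open>
  Finite dimension and finite codimension enter only through this form of the exchange lemma.
  Repetitions in the family count as dependencies.
\<close>

lemma infinite_family_dependent:
  fixes y :: "'i \<Rightarrow> 'a \<Rightarrow> complex"
  assumes "infinite C" and F: "finite F" and y: "\<And>c. c \<in> C \<Longrightarrow> y c \<in> cfun_span F"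
  obtains D k d where "finite D" "D \<subseteq> C" "d \<in> D" "k d \<noteq> 0"
    "(\<Sum>c\<in>D. cfun_scale (k c) (y c)) = 0"
proof (cases "inj_on y C")
  case False
  then obtain c d where cd: "c \<in> C" "d \<in> C" "c \<noteq> d" "y c = y d"
    by (auto simp: inj_on_def)
  show thesis
  proof (rule that)
    show "(\<Sum>i\<in>{c, d}. cfun_scale (if i = c then 1 else - 1) (y i)) = 0"
      using cd by (simp add: fun_eq_iff cfun_scale_def)
  qed (use cd in auto)
next
  case True
  then have "infinite (y ` C)"
    using \<open>infinite C\<close> finite_image_iff by blast
  then have "cfun.dependent (y ` C)"
    using cfun.independent_span_bound[OF F, of "y ` C"] y by auto
  then obtain T k v where T: "finite T" "T \<subseteq> y ` C" "v \<in> T" "k v \<noteq> 0"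
      "(\<Sum>v\<in>T. cfun_scale (k v) v) = 0"
    by (auto simp: cfun.dependent_explicit)
  define D where "D = C \<inter> y -` T"
  have inj: "inj_on y D"
    using True by (rule inj_on_subset) (auto simp: D_def)
  have im: "y ` D = T"
    using T(2) by (auto simp: D_def)
  obtain d where d: "d \<in> D" "v = y d"
    using T(3) im by auto
  show thesis
  proof (rule that)
    show "finite D"
      using T(1) im inj finite_image_iff by blast
    show "(\<Sum>c\<in>D. cfun_scale (k (y c)) (y c)) = 0"
      using T(5) sum.reindex[OF inj, of "\<lambda>v. cfun_scale (k v) v"] by (simp add: im)
  qed (use d T(4) in \<open>auto simp: D_def\<close>)
qed


section \<open>Orthogonal sums of copies of an operator\<close>

text \<open>
  The coordinate maps \<open>P c\<close> identify \<open>\<ell>\<^sup>2(S)\<close> with the Hilbert sum of copies of \<open>\<ell>\<^sup>2(B)\<close> indexed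
  by \<open>C\<close>: Parseval's identity makes the identification isometric, and \<open>P_onto\<close> makes it onto.
\<close>

locale ell2_decomposition =
  fixes S :: "'a set" and C :: "'c set" and B :: "'b set"
    and P :: "'c \<Rightarrow> ('a \<Rightarrow> complex) \<Rightarrow> ('b \<Rightarrow> complex)"
  assumes P_add: "\<lbrakk>c \<in> C; u \<in> ell2 S; v \<in> ell2 S\<rbrakk> \<Longrightarrow> P c (u + v) = P c u + P c v"
    and P_scale: "\<lbrakk>c \<in> C; u \<in> ell2 S\<rbrakk> \<Longrightarrow> P c (cfun_scale k u) = cfun_scale k (P c u)"
    and P_ell2: "\<lbrakk>c \<in> C; u \<in> ell2 S\<rbrakk> \<Longrightarrow> P c u \<in> ell2 B"
    and P_parseval: "u \<in> ell2 S \<Longrightarrow> ((\<lambda>c. (ell2_norm B (P c u))\<^sup>2) has_sum (ell2_norm S u)\<^sup>2) C"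
    and P_onto: "\<lbrakk>\<And>c. c \<in> C \<Longrightarrow> w c \<in> ell2 B; (\<lambda>c. (ell2_norm B (w c))\<^sup>2) summable_on C\<rbrakk>
      \<Longrightarrow> \<exists>u\<in>ell2 S. \<forall>c\<in>C. P c u = w c"
begin

lemma P_diff:
  assumes "c \<in> C" "u \<in> ell2 S" "v \<in> ell2 S"
  shows "P c (u - v) = P c u - P c v"
  unfolding diff_eq_add_scale by (simp only: P_add P_scale ell2_scale assms)

lemma P_zero: "c \<in> C \<Longrightarrow> P c 0 = 0"
  using P_diff[of c 0 0] by simp

lemma P_sum:
  assumes "c \<in> C" "\<And>i. i \<in> I \<Longrightarrow> u i \<in> ell2 S"
  shows "P c (\<Sum>i\<in>I. cfun_scale (k i) (u i)) = (\<Sum>i\<in>I. cfun_scale (k i) (P c (u i)))"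
  using assms(2)
proof (induction I rule: infinite_finite_induct)
  case (insert i I)
  have "P c (cfun_scale (k i) (u i) + (\<Sum>i\<in>I. cfun_scale (k i) (u i))) =
      P c (cfun_scale (k i) (u i)) + P c (\<Sum>i\<in>I. cfun_scale (k i) (u i))"
    using insert.prems assms(1) by (intro P_add ell2_sum ell2_scale) auto
  also have "P c (cfun_scale (k i) (u i)) = cfun_scale (k i) (P c (u i))"
    using insert.prems assms(1) by (intro P_scale) auto
  also have "P c (\<Sum>i\<in>I. cfun_scale (k i) (u i)) = (\<Sum>i\<in>I. cfun_scale (k i) (P c (u i)))"
    using insert.prems by (intro insert.IH) auto
  finally show ?case
    unfolding sum.insert[OF insert.hyps(1,2)] .
qed (simp_all add: P_zero assms(1))

lemma P_inject:
  assumes "u \<in> ell2 S" "v \<in> ell2 S" "\<And>c. c \<in> C \<Longrightarrow> P c u = P c v"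
  shows "u = v"
proof -
  have "u - v = 0"
  proof (rule ell2_norm_eq_0D)
    show uv: "u - v \<in> ell2 S"
      by (intro ell2_diff assms)
    have "((\<lambda>c. (ell2_norm B (P c (u - v)))\<^sup>2) has_sum 0) C"
      by (rule has_sum_0) (simp add: P_diff assms)
    from has_sum_unique[OF P_parseval[OF uv] this] show "ell2_norm S (u - v) = 0"
      by simp
  qed
  then show ?thesis
    by simp
qed

definition assemble :: "('c \<Rightarrow> 'b \<Rightarrow> complex) \<Rightarrow> 'a \<Rightarrow> complex" where
  "assemble w = (SOME u. u \<in> ell2 S \<and> (\<forall>c\<in>C. P c u = w c))"

lemma assemble:
  assumes "\<And>c. c \<in> C \<Longrightarrow> w c \<in> ell2 B" "(\<lambda>c. (ell2_norm B (w c))\<^sup>2) summable_on C"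
  shows "assemble w \<in> ell2 S" and "c \<in> C \<Longrightarrow> P c (assemble w) = w c"
proof -
  have "\<exists>u. u \<in> ell2 S \<and> (\<forall>c\<in>C. P c u = w c)"
    using P_onto[OF assms] by blast
  from someI_ex[OF this] show "assemble w \<in> ell2 S" and "c \<in> C \<Longrightarrow> P c (assemble w) = w c"
    unfolding assemble_def by blast+
qed

lemma assemble_finite:
  assumes "finite D" "D \<subseteq> C" "\<And>c. c \<in> D \<Longrightarrow> w c \<in> ell2 B"
  shows "assemble (\<lambda>c. if c \<in> D then w c else 0) \<in> ell2 S"
    and "c \<in> C \<Longrightarrow> P c (assemble (\<lambda>c. if c \<in> D then w c else 0)) = (if c \<in> D then w c else 0)"
proof -
  have "((\<lambda>c. (ell2_norm B (if c \<in> D then w c else 0))\<^sup>2) has_sum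
      (\<Sum>c\<in>D. (ell2_norm B (if c \<in> D then w c else 0))\<^sup>2)) C"
    by (rule has_sum_finite_neutralI[OF _ _ _ refl]) (use assms in auto)
  then have s: "(\<lambda>c. (ell2_norm B (if c \<in> D then w c else 0))\<^sup>2) summable_on C"
    by (rule has_sum_imp_summable)
  show "assemble (\<lambda>c. if c \<in> D then w c else 0) \<in> ell2 S"
    by (rule assemble(1)[OF _ s]) (use assms in auto)
  show "c \<in> C \<Longrightarrow> P c (assemble (\<lambda>c. if c \<in> D then w c else 0)) = (if c \<in> D then w c else 0)"
    by (rule assemble(2)[OF _ s]) (use assms in auto)
qed

definition ampliation :: "(('b \<Rightarrow> complex) \<Rightarrow> 'b \<Rightarrow> complex) \<Rightarrow> ('a \<Rightarrow> complex) \<Rightarrow> 'a \<Rightarrow> complex" where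
  "ampliation X = (\<lambda>u\<in>ell2 S. assemble (\<lambda>c. X (P c u)))"

lemma ampliation:
  assumes X: "bounded_operator B X"
  shows P_ampliation: "\<lbrakk>c \<in> C; u \<in> ell2 S\<rbrakk> \<Longrightarrow> P c (ampliation X u) = X (P c u)"
    and bounded_ampliation: "bounded_operator S (ampliation X)"
proof -
  obtain K where K: "0 \<le> K" "\<And>u. u \<in> ell2 B \<Longrightarrow> ell2_norm B (X u) \<le> K * ell2_norm B u"
    by (rule bounded_operator_bound[OF X]) blast
  let ?A = "\<lambda>u. assemble (\<lambda>c. X (P c u))"
  have bound: "(ell2_norm B (X (P c u)))\<^sup>2 \<le> K\<^sup>2 * (ell2_norm B (P c u))\<^sup>2"
    if "c \<in> C" "u \<in> ell2 S" for c u
    using power_mono[OF K(2)[OF P_ell2[OF that]] ell2_norm_nonneg, of 2]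
    by (simp add: power_mult_distrib)
  have dom: "((\<lambda>c. K\<^sup>2 * (ell2_norm B (P c u))\<^sup>2) has_sum K\<^sup>2 * (ell2_norm S u)\<^sup>2) C"
    if "u \<in> ell2 S" for u
    by (intro has_sum_cmult_right P_parseval that)
  have summable: "(\<lambda>c. (ell2_norm B (X (P c u)))\<^sup>2) summable_on C" if "u \<in> ell2 S" for u
    by (rule summable_on_comparison_test[OF has_sum_imp_summable[OF dom[OF that]]])
      (use bound that in auto)
  have A: "?A u \<in> ell2 S" "\<And>c. c \<in> C \<Longrightarrow> P c (?A u) = X (P c u)" if "u \<in> ell2 S" for u
    by (rule assemble[OF _ summable[OF that]]; simp add: bounded_operatorD(1)[OF X] P_ell2 that)+
  show "\<lbrakk>c \<in> C; u \<in> ell2 S\<rbrakk> \<Longrightarrow> P c (ampliation X u) = X (P c u)"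
    by (simp add: ampliation_def A)
  show "bounded_operator S (ampliation X)"
    unfolding ampliation_def
  proof (rule bounded_operatorI)
    fix u v assume uv: "u \<in> ell2 S" "v \<in> ell2 S"
    show "?A (u + v) = ?A u + ?A v"
      by (rule P_inject)
        (simp_all only: A P_add P_ell2 uv ell2_add bounded_operatorD(2)[OF X])
  next
    fix c u assume u: "u \<in> ell2 S"
    show "?A (cfun_scale c u) = cfun_scale c (?A u)"
      by (rule P_inject)
        (simp_all only: A P_scale P_ell2 u ell2_scale bounded_operatorD(3)[OF X])
  next
    fix u assume u: "u \<in> ell2 S"
    have "(ell2_norm S (?A u))\<^sup>2 \<le> K\<^sup>2 * (ell2_norm S u)\<^sup>2"
      by (rule has_sum_mono[OF P_parseval[OF A(1)[OF u]] dom[OF u]]) (simp add: A u bound)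
    then have "(ell2_norm S (?A u))\<^sup>2 \<le> (K * ell2_norm S u)\<^sup>2"
      by (simp add: power_mult_distrib)
    then show "ell2_norm S (?A u) \<le> K * ell2_norm S u"
      by (rule power2_le_imp_le) (simp add: K)
  qed (rule A)
qed

lemma invertible_ampliation:
  assumes "invertible_operator B X"
  shows "invertible_operator S (ampliation X)"
proof -
  obtain Y where X: "bounded_operator B X" and Y: "bounded_operator B Y"
    and XY: "\<And>u. u \<in> ell2 B \<Longrightarrow> X (Y u) = u" "\<And>u. u \<in> ell2 B \<Longrightarrow> Y (X u) = u"
    using assms by (auto simp: invertible_operator_def)
  have "ampliation X (ampliation Y u) = u \<and> ampliation Y (ampliation X u) = u"
    if u: "u \<in> ell2 S" for u
  proof
    have Au: "ampliation X u \<in> ell2 S" "ampliation Y u \<in> ell2 S"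
      by (intro bounded_operatorD(1)[OF bounded_ampliation] X Y u)+
    show "ampliation X (ampliation Y u) = u"
      by (rule P_inject[OF bounded_operatorD(1)[OF bounded_ampliation[OF X] Au(2)] u])
        (simp add: P_ampliation X Y Au u XY P_ell2)
    show "ampliation Y (ampliation X u) = u"
      by (rule P_inject[OF bounded_operatorD(1)[OF bounded_ampliation[OF Y] Au(1)] u])
        (simp add: P_ampliation X Y Au u XY P_ell2)
  qed
  then show ?thesis
    unfolding invertible_operator_def using bounded_ampliation X Y by blast
qed

end

text \<open>
  With infinitely many copies, every defect of \<open>X\<close> is repeated infinitely often, so that a Fredholm
  ampliation leaves no room for any defect.
\<close>

locale infinite_ell2_decomposition = ell2_decomposition S C B P
  for S :: "'a set" and C :: "'c set" and B :: "'b set" and P +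
  assumes infinite_C: "infinite C"
begin

text \<open>
  A nonzero vector in the kernel of \<open>X\<close> has one copy in each summand, and these copies are linearly
  independent elements of the kernel of the ampliation.
\<close>

lemma injective_if_finite_kernel:
  assumes X: "bounded_operator B X"
    and F: "finite F" "{u \<in> ell2 S. ampliation X u = 0} = cfun_span F"
    and u: "u \<in> ell2 B" "X u = 0"
  shows "u = 0"
proof -
  define e where "e d = assemble (\<lambda>c. if c \<in> {d} then u else 0)" for d
  have e: "e d \<in> ell2 S" "\<And>c. c \<in> C \<Longrightarrow> P c (e d) = (if c = d then u else 0)" if "d \<in> C" for d
    unfolding e_def using assemble_finite[of "{d}" "\<lambda>_. u"] that u by auto
  have e_span: "e d \<in> cfun_span F" if d: "d \<in> C" for d
  proof -
    have "X (if c = d then u else 0) = 0" for c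
      using u bounded_operator_zero[OF X] by (cases "c = d") auto
    then have "ampliation X (e d) = 0"
      by (intro P_inject[OF bounded_operatorD(1)[OF bounded_ampliation[OF X] e(1)[OF d]] ell2_zero(1)])
        (simp only: P_ampliation[OF X] e d P_zero)
    then show ?thesis
      using e(1)[OF d] by (simp flip: F(2))
  qed
  obtain D k d where D: "finite D" "D \<subseteq> C" "d \<in> D" "k d \<noteq> 0"
      "(\<Sum>c\<in>D. cfun_scale (k c) (e c)) = 0"
    by (rule infinite_family_dependent[where y = e, OF infinite_C F(1) e_span]) (assumption, rule that)
  have "0 = P d (\<Sum>c\<in>D. cfun_scale (k c) (e c))"
    unfolding D(5) using D(2,3) P_zero by auto
  also have "\<dots> = (\<Sum>c\<in>D. cfun_scale (k c) (P d (e c)))"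
    by (rule P_sum) (use D e in auto)
  also have "\<dots> = (\<Sum>c\<in>D. if c = d then cfun_scale (k d) u else 0)"
    by (rule sum.cong[OF refl]) (use D(2,3) e(2) in \<open>auto simp: subset_iff\<close>)
  also have "\<dots> = cfun_scale (k d) u"
    using D by simp
  finally show "u = 0"
    using D(4) by simp
qed

text \<open>
  If \<open>w\<close> is not in the range of \<open>X\<close>, then no nontrivial combination of the copies of \<open>w\<close> is in
  the range of the ampliation.
\<close>

lemma surjective_if_finite_codimension:
  assumes X: "bounded_operator B X"
    and F: "finite F" "ell2 S = {v + w | v w. v \<in> ampliation X ` ell2 S \<and> w \<in> cfun_span F}"
    and w: "w \<in> ell2 B"
  shows "\<exists>u\<in>ell2 B. X u = w"
proof -
  define e where "e d = assemble (\<lambda>c. if c \<in> {d} then w else 0)" for d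
  have e: "e d \<in> ell2 S" "\<And>c. c \<in> C \<Longrightarrow> P c (e d) = (if c = d then w else 0)" if "d \<in> C" for d
    unfolding e_def using assemble_finite[of "{d}" "\<lambda>_. w"] that w by auto
  have "\<exists>z\<in>ell2 S. e d - ampliation X z \<in> cfun_span F" if "d \<in> C" for d
  proof -
    have "e d \<in> {v + w | v w. v \<in> ampliation X ` ell2 S \<and> w \<in> cfun_span F}"
      using e(1)[OF that] F(2) by simp
    then show ?thesis
      by force
  qed
  then obtain z where z: "\<And>d. d \<in> C \<Longrightarrow> z d \<in> ell2 S"
      "\<And>d. d \<in> C \<Longrightarrow> e d - ampliation X (z d) \<in> cfun_span F"
    by metis
  obtain D k d where D: "finite D" "D \<subseteq> C" "d \<in> D" "k d \<noteq> 0"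
      "(\<Sum>c\<in>D. cfun_scale (k c) (e c - ampliation X (z c))) = 0"
    by (rule infinite_family_dependent[where y = "\<lambda>c. e c - ampliation X (z c)",
          OF infinite_C F(1) z(2)]) (assumption, rule that)
  define y where "y = (\<Sum>c\<in>D. cfun_scale (k c) (z c))"
  have y: "y \<in> ell2 S"
    unfolding y_def by (intro ell2_sum ell2_scale z) (use D in auto)
  have "(\<Sum>c\<in>D. cfun_scale (k c) (e c)) = (\<Sum>c\<in>D. cfun_scale (k c) (ampliation X (z c)))"
    using D(5) by (simp add: cfun.scale_right_diff_distrib sum_subtractf)
  also have "\<dots> = ampliation X y"
    unfolding y_def by (rule bounded_operator_sum[OF bounded_ampliation[OF X], symmetric])
      (use D z in auto)
  finally have "X (P d y) = P d (\<Sum>c\<in>D. cfun_scale (k c) (e c))"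
    using D y by (simp add: P_ampliation[OF X] subset_iff)
  also have "\<dots> = (\<Sum>c\<in>D. cfun_scale (k c) (P d (e c)))"
    by (rule P_sum) (use D e in auto)
  also have "\<dots> = (\<Sum>c\<in>D. if c = d then cfun_scale (k d) w else 0)"
    by (rule sum.cong[OF refl]) (use D(2,3) e(2) in \<open>auto simp: subset_iff\<close>)
  also have "\<dots> = cfun_scale (k d) w"
    using D by simp
  finally have eq: "X (P d y) = cfun_scale (k d) w" .
  have Pdy: "P d y \<in> ell2 B"
    by (intro P_ell2 y) (use D in auto)
  have "X (cfun_scale (1 / k d) (P d y)) = w"
    using D(4) by (simp add: bounded_operatorD(3)[OF X Pdy] eq)
  then show ?thesis
    using ell2_scale(1)[OF Pdy] by blast
qed

text \<open>
  An element of the Hilbert sum whose coordinates are all in the range of \<open>X\<close> is a limit of elements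
  of the range of the ampliation, namely of its finite sections.
\<close>

lemma closed_range_imp_square_summable:
  assumes X: "bounded_operator B X"
    and inj: "\<And>u. u \<in> ell2 B \<Longrightarrow> X u = 0 \<Longrightarrow> u = 0"
    and closed: "closedin (Metric_space.mtopology (ell2 S) (ell2_dist S)) (ampliation X ` ell2 S)"
    and v: "\<And>c. c \<in> C \<Longrightarrow> v c \<in> ell2 B"
    and Xv: "(\<lambda>c. (ell2_norm B (X (v c)))\<^sup>2) summable_on C"
  shows "(\<lambda>c. (ell2_norm B (v c))\<^sup>2) summable_on C"
proof -
  interpret M: Metric_space "ell2 S" "ell2_dist S"
    by (rule Metric_space_ell2)
  define y where "y = assemble (\<lambda>c. X (v c))"
  have y: "y \<in> ell2 S" "\<And>c. c \<in> C \<Longrightarrow> P c y = X (v c)"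
    unfolding y_def by (rule assemble[OF _ Xv]; simp add: bounded_operatorD(1)[OF X] v)+
  have "y \<in> ampliation X ` ell2 S"
  proof (rule ccontr)
    assume "y \<notin> ampliation X ` ell2 S"
    then obtain r where r: "0 < r" "disjnt (ampliation X ` ell2 S) (M.mball y r)"
      using closed y(1) unfolding M.closedin_metric by blast
    have "0 < r\<^sup>2 / 2"
      using r by simp
    then obtain D where D: "finite D" "D \<subseteq> C"
        and d: "dist (\<Sum>c\<in>D. (ell2_norm B (P c y))\<^sup>2) ((ell2_norm S y)\<^sup>2) \<le> r\<^sup>2 / 2"
      using has_sum_finite_approximation[OF P_parseval[OF y(1)]] by blast
    have vD: "v c \<in> ell2 B" if "c \<in> D" for c
      using v D that by blast
    \<comment> \<open>\<open>z\<close> is chosen so that its image has the coordinates of \<open>y\<close> over \<open>D\<close> and no others.\<close>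
    define z where "z = assemble (\<lambda>c. if c \<in> D then v c else 0)"
    have z: "z \<in> ell2 S" "\<And>c. c \<in> C \<Longrightarrow> P c z = (if c \<in> D then v c else 0)"
      unfolding z_def by (rule assemble_finite[OF D vD]; assumption)+
    have Az: "ampliation X z \<in> ell2 S"
      by (rule bounded_operatorD(1)[OF bounded_ampliation[OF X] z(1)])
    have yAz: "y - ampliation X z \<in> ell2 S"
      by (rule ell2_diff[OF y(1) Az])
    have coord: "P c (y - ampliation X z) = (if c \<in> D then 0 else P c y)" if "c \<in> C" for c
      by (simp add: P_diff y Az that P_ampliation[OF X] z bounded_operator_zero[OF X])
    have "((\<lambda>c. (ell2_norm B (P c y))\<^sup>2) has_sum
        ((ell2_norm S y)\<^sup>2 - (\<Sum>c\<in>D. (ell2_norm B (P c y))\<^sup>2))) (C - D)"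
      by (rule has_sum_Diff[OF P_parseval[OF y(1)] has_sum_finite[OF D(1)] D(2)])
    then have "((\<lambda>c. (ell2_norm B (P c (y - ampliation X z)))\<^sup>2) has_sum
        ((ell2_norm S y)\<^sup>2 - (\<Sum>c\<in>D. (ell2_norm B (P c y))\<^sup>2))) C"
      by (rule iffD1[OF has_sum_cong_neutral, rotated -1]) (auto simp: coord)
    from has_sum_unique[OF P_parseval[OF yAz] this]
    have "(ell2_norm S (y - ampliation X z))\<^sup>2 \<le> r\<^sup>2 / 2"
      using d unfolding dist_real_def by linarith
    also have "\<dots> < r\<^sup>2"
      using r by simp
    finally have "ell2_norm S (y - ampliation X z) < r"
      by (rule power_less_imp_less_base) (use r in simp)
    then have "ampliation X z \<in> M.mball y r"
      using y(1) Az by (simp add: M.in_mball ell2_dist_def)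
    then show False
      using r(2) z(1) by (auto simp: disjnt_iff)
  qed
  then obtain x where x: "x \<in> ell2 S" "ampliation X x = y"
    by auto
  have "P c x = v c" if c: "c \<in> C" for c
  proof -
    have "X (P c x) = X (v c)"
      using P_ampliation[OF X c x(1)] x(2) y(2)[OF c] by simp
    then have "X (P c x - v c) = 0"
      by (simp add: bounded_operator_diff[OF X P_ell2[OF c x(1)] v[OF c]])
    then have "P c x - v c = 0"
      by (rule inj[OF ell2_diff[OF P_ell2[OF c x(1)] v[OF c]]])
    then show ?thesis
      by simp
  qed
  then show ?thesis
    using has_sum_imp_summable[OF P_parseval[OF x(1)]]
    by (simp cong: summable_on_cong)
qed

text \<open>
  Were \<open>X\<close> not bounded below, one copy of \<open>X\<close> could be used for each \<open>n\<close> to place a vector of norm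
  at least \<open>n\<close> whose image has norm \<open>2\<^sup>-\<^sup>n\<close>; the images would be square summable and the vectors
  would not, against the previous lemma. This gives a bounded inverse without the open mapping
  theorem.
\<close>

lemma bounded_below_if_closed_range:
  assumes X: "bounded_operator B X"
    and inj: "\<And>u. u \<in> ell2 B \<Longrightarrow> X u = 0 \<Longrightarrow> u = 0"
    and closed: "closedin (Metric_space.mtopology (ell2 S) (ell2_dist S)) (ampliation X ` ell2 S)"
  shows "\<exists>K. \<forall>u\<in>ell2 B. ell2_norm B u \<le> K * ell2_norm B (X u)"
proof (rule ccontr)
  assume not_bounded: "\<nexists>K. \<forall>u\<in>ell2 B. ell2_norm B u \<le> K * ell2_norm B (X u)"
  have "\<exists>u\<in>ell2 B. real n \<le> ell2_norm B u \<and> ell2_norm B (X u) = (1/2) ^ n" for n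
  proof -
    obtain u where u: "u \<in> ell2 B" "real n * 2 ^ n * ell2_norm B (X u) < ell2_norm B u"
      using not_bounded by (metis not_le)
    have "u \<noteq> 0"
      using u(2) bounded_operator_zero[OF X] by auto
    then have pos: "0 < ell2_norm B (X u)"
      using inj[OF u(1)] ell2_norm_eq_0D[OF bounded_operatorD(1)[OF X u(1)]]
      by (metis ell2_norm_nonneg less_eq_real_def)
    define t where "t = (1/2) ^ n / ell2_norm B (X u)"
    have t: "0 < t"
      using pos by (simp add: t_def)
    have "real n = real n * 2 ^ n * ell2_norm B (X u) * t"
      using pos by (simp add: t_def power_divide)
    also have "\<dots> \<le> ell2_norm B u * t"
      using u(2) t by (intro mult_right_mono) auto
    finally have "real n \<le> ell2_norm B (cfun_scale t u)"
      using t u(1) by (simp add: ell2_scale mult.commute)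
    moreover have "ell2_norm B (X (cfun_scale t u)) = (1/2) ^ n"
      using t pos u(1) by (simp add: bounded_operatorD[OF X] ell2_scale) (simp add: t_def)
    ultimately show ?thesis
      using ell2_scale(1)[OF u(1)] by blast
  qed
  then obtain u where u: "\<And>n. u n \<in> ell2 B" "\<And>n. real n \<le> ell2_norm B (u n)"
      "\<And>n. ell2_norm B (X (u n)) = (1/2) ^ n"
    by metis
  obtain g :: "nat \<Rightarrow> 'c" where g: "inj g" "range g \<subseteq> C"
    using infinite_countable_subset[OF infinite_C] by blast
  define v where "v c = (if c \<in> range g then u (inv g c) else 0)" for c
  have v_ell2: "v c \<in> ell2 B" for c
    using u(1) by (auto simp: v_def)
  have v_g: "v (g n) = u n" for n
    using g(1) by (simp add: v_def)
  have "summable (\<lambda>n. ((1/2) ^ n)\<^sup>2 :: real)"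
    using summable_geometric[of "1/4 :: real"] by (simp add: power_divide power2_eq_square flip: power_mult_distrib)
  then have "(\<lambda>n. (ell2_norm B (X (v (g n))))\<^sup>2) summable_on UNIV"
    by (simp add: v_g u summable_on_UNIV_nonneg_real_iff)
  then have "(\<lambda>c. (ell2_norm B (X (v c)))\<^sup>2) summable_on range g"
    using summable_on_reindex[OF g(1), of "\<lambda>c. (ell2_norm B (X (v c)))\<^sup>2"] by (simp add: o_def)
  then have Xv: "(\<lambda>c. (ell2_norm B (X (v c)))\<^sup>2) summable_on C"
    by (rule iffD1[OF summable_on_cong_neutral, rotated -1])
      (use g in \<open>auto simp: v_def bounded_operator_zero[OF X]\<close>)
  have "(\<lambda>c. (ell2_norm B (v c))\<^sup>2) summable_on C"
    by (rule closed_range_imp_square_summable[OF X inj closed v_ell2 Xv])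
  then have sum: "((\<lambda>c. (ell2_norm B (v c))\<^sup>2) has_sum (\<Sum>\<^sub>\<infinity>c\<in>C. (ell2_norm B (v c))\<^sup>2)) C"
    by simp
  define s where "s = (\<Sum>\<^sub>\<infinity>c\<in>C. (ell2_norm B (v c))\<^sup>2)"
  have "(real n)\<^sup>2 \<le> s" for n
  proof -
    have "(real n)\<^sup>2 \<le> (ell2_norm B (v (g n)))\<^sup>2"
      using u(2) by (simp add: v_g)
    also have "\<dots> = (\<Sum>c\<in>{g n}. (ell2_norm B (v c))\<^sup>2)"
      by simp
    also have "\<dots> \<le> s"
      unfolding s_def by (rule finite_sum_le_has_sum[OF sum]) (use g in auto)
    finally show ?thesis .
  qed
  moreover obtain n :: nat where n: "max 1 s < real n"
    using reals_Archimedean2 by blast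
  moreover have "real n \<le> (real n)\<^sup>2"
    using n by (intro self_le_power) auto
  ultimately show False
    by (metis max_less_iff_conj not_less order_trans)
qed

theorem fredholm_ampliation_imp_invertible:
  assumes X: "bounded_operator B X" and fred: "fredholm_operator S (ampliation X)"
  shows "invertible_operator B X"
proof -
  obtain F G where F: "finite F" "{u \<in> ell2 S. ampliation X u = 0} = cfun_span F"
    and closed: "closedin (Metric_space.mtopology (ell2 S) (ell2_dist S)) (ampliation X ` ell2 S)"
    and G: "finite G" "ell2 S = {v + w | v w. v \<in> ampliation X ` ell2 S \<and> w \<in> cfun_span G}"
    using fred by (auto simp: fredholm_operator_def)
  have inj: "u = 0" if "u \<in> ell2 B" "X u = 0" for u
    by (rule injective_if_finite_kernel[OF X F that])
  have inj': "u = v" if uv: "u \<in> ell2 B" "v \<in> ell2 B" "X u = X v" for u v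
    using inj[OF ell2_diff[OF uv(1,2)]] by (simp add: bounded_operator_diff[OF X uv(1,2)] uv(3))
  obtain K where K: "\<And>u. u \<in> ell2 B \<Longrightarrow> ell2_norm B u \<le> K * ell2_norm B (X u)"
    using bounded_below_if_closed_range[OF X inj closed] by blast
  obtain Y where Y: "\<And>w. w \<in> ell2 B \<Longrightarrow> Y w \<in> ell2 B" "\<And>w. w \<in> ell2 B \<Longrightarrow> X (Y w) = w"
    using surjective_if_finite_codimension[OF X G] by metis
  have "bounded_operator B (restrict Y (ell2 B))"
  proof (rule bounded_operatorI)
    fix u v assume uv: "u \<in> ell2 B" "v \<in> ell2 B"
    show "Y (u + v) = Y u + Y v"
      by (rule inj') (simp_all only: Y uv ell2_add bounded_operatorD(2)[OF X])
  next
    fix c u assume u: "u \<in> ell2 B"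
    show "Y (cfun_scale c u) = cfun_scale c (Y u)"
      by (rule inj') (simp_all only: Y u ell2_scale bounded_operatorD(3)[OF X])
  next
    fix u assume "u \<in> ell2 B"
    then show "ell2_norm B (Y u) \<le> K * ell2_norm B u"
      using K[OF Y(1)] by (simp add: Y(2))
  qed (rule Y)
  moreover have "Y (X u) = u" if "u \<in> ell2 B" for u
    by (rule inj') (simp_all add: Y bounded_operatorD(1)[OF X] that)
  ultimately show ?thesis
    unfolding invertible_operator_def using X Y bounded_operatorD(1)[OF X]
    by (intro conjI exI[of _ "restrict Y (ell2 B)"]) auto
qed

end

lemma invertible_imp_fredholm:
  assumes "invertible_operator S A"
  shows "fredholm_operator S A"
proof -
  interpret M: Metric_space "ell2 S" "ell2_dist S"
    by (rule Metric_space_ell2)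
  obtain A' where A: "bounded_operator S A" and A': "bounded_operator S A'"
    and inv: "\<And>u. u \<in> ell2 S \<Longrightarrow> A (A' u) = u" "\<And>u. u \<in> ell2 S \<Longrightarrow> A' (A u) = u"
    using assms by (auto simp: invertible_operator_def)
  have range: "A ` ell2 S = ell2 S"
    using inv(1) bounded_operatorD(1)[OF A] bounded_operatorD(1)[OF A'] by force
  have kernel: "{u \<in> ell2 S. A u = 0} = cfun_span {}"
    using inv(2) bounded_operator_zero[OF A] bounded_operator_zero[OF A'] by force
  have "closedin M.mtopology (A ` ell2 S)"
    using closedin_topspace[of M.mtopology] by (simp add: range)
  moreover have "ell2 S = {v + w | v w. v \<in> A ` ell2 S \<and> w \<in> cfun_span {}}"
    by (simp add: range)
  ultimately show ?thesis
    unfolding fredholm_operator_def using A kernel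
    by (intro conjI exI[of _ "{}"]) (assumption | rule finite.emptyI empty_subsetI)+
qed


section \<open>Distance and comparability in the tree\<close>

lemma tree_append_iff: "\<sigma> @ \<tau> \<in> tree q \<longleftrightarrow> \<sigma> \<in> tree q \<and> \<tau> \<in> tree q"
  by (auto simp: tree_def)

lemma tree_take: "\<sigma> \<in> tree q \<Longrightarrow> take n \<sigma> \<in> tree q"
  by (metis append_take_drop_id tree_append_iff)

lemma replicate_0_in_tree: "0 < q \<Longrightarrow> replicate n 0 \<in> tree q"
  by (auto simp: tree_def)

lemma tree_path_length:
  assumes "(\<sigma>, \<tau>) \<in> tree_edges q ^^ n"
  shows "length \<tau> \<le> length \<sigma> + n \<and> length \<sigma> \<le> length \<tau> + n"
  using assms
proof (induction n arbitrary: \<tau>)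
  case (Suc n)
  then obtain \<upsilon> where "(\<sigma>, \<upsilon>) \<in> tree_edges q ^^ n" "(\<upsilon>, \<tau>) \<in> tree_edges q"
    by auto
  with Suc.IH[of \<upsilon>] show ?case
    by (auto simp: tree_edges_def)
qed auto

lemma tree_path_append:
  assumes "\<sigma> @ \<rho> \<in> tree q"
  shows "(\<sigma>, \<sigma> @ \<rho>) \<in> tree_edges q ^^ length \<rho>" "(\<sigma> @ \<rho>, \<sigma>) \<in> tree_edges q ^^ length \<rho>"
  using assms
proof (induction \<rho> rule: rev_induct)
  case (snoc i \<rho>)
  {
    case 1
    then have "(\<sigma>, \<sigma> @ \<rho>) \<in> tree_edges q ^^ length \<rho>"
      by (intro snoc.IH) (simp add: tree_append_iff)
    moreover have "(\<sigma> @ \<rho>, \<sigma> @ \<rho> @ [i]) \<in> tree_edges q"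
      using 1 by (force simp: tree_edges_def tree_def)
    ultimately show ?case
      by auto
  next
    case 2
    then have "(\<sigma> @ \<rho>, \<sigma>) \<in> tree_edges q ^^ length \<rho>"
      by (intro snoc.IH) (simp add: tree_append_iff)
    moreover have "(\<sigma> @ \<rho> @ [i], \<sigma> @ \<rho>) \<in> tree_edges q"
      using 2 by (force simp: tree_edges_def tree_def)
    ultimately show ?case
      using relpow_Suc_I2 by fastforce
  }
qed auto

lemma tree_dist_append:
  assumes "\<sigma> @ \<rho> \<in> tree q"
  shows "tree_dist q \<sigma> (\<sigma> @ \<rho>) = length \<rho>" "tree_dist q (\<sigma> @ \<rho>) \<sigma> = length \<rho>"
  unfolding tree_dist_def
  by (rule Least_equality; use tree_path_append[OF assms] in \<open>auto dest: tree_path_length\<close>)+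

lemma tree_level_eq: "\<sigma> \<in> tree q \<Longrightarrow> tree_level q \<sigma> = length \<sigma>"
  using tree_dist_append(1)[of "[]"] by (simp add: tree_level_def)

lemma tree_dist_1D:
  assumes "\<sigma> \<in> tree q" "\<tau> \<in> tree q" "tree_dist q \<sigma> \<tau> = 1"
  shows "(\<sigma>, \<tau>) \<in> tree_edges q"
proof -
  have "(\<sigma>, \<tau>) \<in> tree_edges q ^^ (length \<sigma> + length \<tau>)"
    by (rule relpow_trans[of _ "[]"])
      (use assms tree_path_append(2)[of "[]" \<sigma>] tree_path_append(1)[of "[]" \<tau>] in auto)
  then have "(\<sigma>, \<tau>) \<in> tree_edges q ^^ tree_dist q \<sigma> \<tau>"
    unfolding tree_dist_def by (rule LeastI)
  with assms(3) show ?thesis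
    by simp
qed

lemma root_geodesic_ray_prefix:
  assumes r: "root_geodesic_ray q r"
  shows "length (r n) = n" and "m \<le> n \<Longrightarrow> \<exists>\<rho>. r n = r m @ \<rho>"
proof -
  have tree: "r n \<in> tree q" for n
    using r by (auto simp: root_geodesic_ray_def)
  have dist: "int (tree_dist q (r m) (r n)) = \<bar>int m - int n\<bar>" for m n
    using r by (simp add: root_geodesic_ray_def)
  have len: "length (r n) = n" for n
    using dist[of 0 n] tree_level_eq[OF tree[of n]] r
    by (simp add: tree_level_def root_geodesic_ray_def)
  then show "length (r n) = n" .
  have step: "\<exists>i. r (Suc n) = r n @ [i]" for n
  proof -
    have "(r n, r (Suc n)) \<in> tree_edges q"
      using dist[of n "Suc n"] by (intro tree_dist_1D tree) simp
    then show ?thesis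
      using len[of n] len[of "Suc n"] by (auto simp: tree_edges_def)
  qed
  show "m \<le> n \<Longrightarrow> \<exists>\<rho>. r n = r m @ \<rho>"
  proof (induction n rule: dec_induct)
    case (step n)
    then show ?case
      using \<open>\<And>n. \<exists>i. r (Suc n) = r n @ [i]\<close>[of n] by auto
  qed simp
qed

text \<open>Every vertex lies on the ray that continues through the children with label \<open>0\<close>.\<close>

lemma tree_le_iff_prefix:
  assumes "0 < q" "\<sigma> \<in> tree q" "\<tau> \<in> tree q"
  shows "tree_le q \<sigma> \<tau> \<longleftrightarrow> (\<exists>\<rho>. \<tau> = \<sigma> @ \<rho>)"
proof
  assume "tree_le q \<sigma> \<tau>"
  then obtain r m n where r: "root_geodesic_ray q r" "\<sigma> = r m" "\<tau> = r n" "length \<sigma> \<le> length \<tau>"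
    using assms by (auto simp: tree_le_def tree_level_eq)
  then have "m \<le> n"
    by (simp add: root_geodesic_ray_prefix(1))
  then show "\<exists>\<rho>. \<tau> = \<sigma> @ \<rho>"
    using root_geodesic_ray_prefix(2)[OF r(1)] r by simp
next
  assume "\<exists>\<rho>. \<tau> = \<sigma> @ \<rho>"
  then obtain \<rho> where \<rho>: "\<tau> = \<sigma> @ \<rho>" ..
  define r where "r n = take n (\<tau> @ replicate n 0)" for n
  have tree: "r n \<in> tree q" for n
    unfolding r_def by (intro tree_take) (simp add: tree_append_iff assms replicate_0_in_tree)
  have len: "length (r n) = n" for n
    by (simp add: r_def)
  have prefix: "r n = r m @ drop m (r n)" if "m \<le> n" for m n
  proof -
    have "take m (r n) = r m"
      using that by (auto simp: r_def min_def take_append)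
    then show ?thesis
      by (metis append_take_drop_id)
  qed
  have le: "tree_dist q (r m) (r n) = n - m \<and> tree_dist q (r n) (r m) = n - m" if "m \<le> n" for m n
    using tree_dist_append[of "r m" "drop m (r n)" q] tree[of n]
    by (simp add: prefix[OF that, symmetric] len)
  have "root_geodesic_ray q r"
    unfolding root_geodesic_ray_def
  proof (intro conjI allI)
    fix m n
    show "int (tree_dist q (r m) (r n)) = \<bar>int m - int n\<bar>"
      using le[of m n] le[of n m] by (cases "m \<le> n") auto
  qed (use tree in \<open>auto simp: r_def\<close>)
  moreover have "\<sigma> = r (length \<sigma>)" "\<tau> = r (length \<tau>)"
    by (simp_all add: r_def \<rho>)
  moreover have "tree_level q \<sigma> \<le> tree_level q \<tau>"
    unfolding tree_level_eq[OF assms(2)] tree_level_eq[OF assms(3)] by (simp add: \<rho>)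
  ultimately show "tree_le q \<sigma> \<tau>"
    unfolding tree_le_def by blast
qed

lemma powr_minus_half:
  assumes "0 < q"
  shows "real q powr (- real n / 2) = (1 / sqrt q) ^ n"
proof -
  have "real q powr (- (1 / 2)) = 1 / sqrt q"
    unfolding powr_minus_divide by (simp add: powr_half_sqrt)
  then have "(1 / sqrt q) ^ n = (real q powr (- (1 / 2))) powr real n"
    using assms powr_realpow[of "1 / sqrt q" n] by simp
  also have "\<dots> = real q powr (- real n / 2)"
    unfolding powr_powr by (rule arg_cong[of _ _ "(powr) (real q)"]) simp
  finally show ?thesis
    by simp
qed

lemma tree_toeplitz_kernel_append:
  assumes "0 < q" "\<sigma> @ \<rho> \<in> tree q"
  shows "tree_toeplitz_kernel q f (\<sigma> @ \<rho>) \<sigma> =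
      of_real ((1 / sqrt q) ^ length \<rho>) * fourier_coeff f (int (length \<rho>))"
    and "tree_toeplitz_kernel q f \<sigma> (\<sigma> @ \<rho>) =
      of_real ((1 / sqrt q) ^ length \<rho>) * fourier_coeff f (- int (length \<rho>))"
proof -
  have \<sigma>: "\<sigma> \<in> tree q"
    using assms(2) by (simp add: tree_append_iff)
  have "(\<sigma> @ \<rho>, \<sigma>) \<in> comparable_pairs q" "(\<sigma>, \<sigma> @ \<rho>) \<in> comparable_pairs q"
    using assms \<sigma> tree_le_iff_prefix[OF assms(1) \<sigma> assms(2)] by (auto simp: comparable_pairs_def)
  then show "tree_toeplitz_kernel q f (\<sigma> @ \<rho>) \<sigma> =
      of_real ((1 / sqrt q) ^ length \<rho>) * fourier_coeff f (int (length \<rho>))"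
    and "tree_toeplitz_kernel q f \<sigma> (\<sigma> @ \<rho>) =
      of_real ((1 / sqrt q) ^ length \<rho>) * fourier_coeff f (- int (length \<rho>))"
    using assms \<sigma>
    by (simp_all only: tree_toeplitz_kernel_def tree_dist_append tree_level_eq powr_minus_half) simp_all
qed

lemma tree_toeplitz_kernel_incomparable:
  assumes "0 < q" "\<sigma> \<in> tree q" "\<tau> \<in> tree q" "\<nexists>\<rho>. \<tau> = \<sigma> @ \<rho>" "\<nexists>\<rho>. \<sigma> = \<tau> @ \<rho>"
  shows "tree_toeplitz_kernel q f \<sigma> \<tau> = 0"
  using assms tree_le_iff_prefix[of q \<sigma> \<tau>] tree_le_iff_prefix[of q \<tau> \<sigma>]
  by (simp add: tree_toeplitz_kernel_def comparable_pairs_def)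


section \<open>The Hartley transform on the levels of the tree\<close>

lemma sum_cis_roots_of_unity:
  fixes m :: int
  assumes "0 < q"
  shows "(\<Sum>k<q. cis (2 * pi * m * real k / q)) = (if int q dvd m then of_nat q else 0)"
proof -
  define z where "z = cis (2 * pi * m / q)"
  have pow: "cis (2 * pi * m * real k / q) = z ^ k" for k
    unfolding z_def Complex.DeMoivre by (rule arg_cong[of _ _ cis]) simp
  have z_eq_1: "z = 1 \<longleftrightarrow> int q dvd m"
  proof
    assume "z = 1"
    then have "cos (2 * pi * m / q) = 1"
      by (simp add: z_def complex_eq_iff)
    then obtain n :: int where "2 * pi * m / q = n * 2 * pi"
      by (auto simp: cos_one_2pi_int)
    then have "real_of_int m = real_of_int (n * int q)"
      using assms by (simp add: field_simps)
    then show "int q dvd m"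
      by (metis dvd_triv_right of_int_eq_iff)
  next
    assume "int q dvd m"
    then obtain n where "m = int q * n" ..
    then have "2 * pi * m / q = 2 * pi * of_int n"
      using assms by simp
    then show "z = 1"
      by (simp only: z_def cis_multiple_2pi Ints_of_int)
  qed
  have "2 * pi * m * q / q = 2 * pi * of_int m"
    using assms by simp
  then have "z ^ q = 1"
    by (simp only: cis_multiple_2pi Ints_of_int flip: pow)
  then have "(\<Sum>k<q. z ^ k) = (if z = 1 then of_nat q else 0)"
    by (simp add: geometric_sum)
  then show ?thesis
    by (simp only: pow z_eq_1)
qed

text \<open>
  The matrix of the discrete Hartley transform. Like the matrix of the discrete Fourier transform it
  is unitary with a constant first column, but it is also real and symmetric, hence its own inverse.
\<close>

definition hartley :: "nat \<Rightarrow> nat \<Rightarrow> nat \<Rightarrow> real" where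
  "hartley q i j = (cos (2 * pi * (i * j) / q) + sin (2 * pi * (i * j) / q)) / sqrt q"

lemma hartley_sym: "hartley q i j = hartley q j i"
  by (simp add: hartley_def mult.commute)

lemma hartley_0 [simp]: "hartley q i 0 = 1 / sqrt q"
  by (simp add: hartley_def)

text \<open>
  Since \<open>(cos x + sin x) * (cos y + sin y) = cos (x - y) + sin (x + y)\<close>, orthogonality reduces to
  sums over roots of unity, whose imaginary parts always cancel.
\<close>

lemma hartley_orthogonal:
  assumes "i < q" "j < q"
  shows "(\<Sum>k<q. hartley q i k * hartley q k j) = (if i = j then 1 else 0)"
proof -
  have q: "0 < q"
    using assms by simp
  define m where "m = int i - int j"
  define n where "n = int i + int j"
  have product: "hartley q i k * hartley q k j =
      (Re (cis (2 * pi * m * real k / q)) + Im (cis (2 * pi * n * real k / q))) / q" for k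
  proof -
    define x where "x = 2 * pi * (i * k) / q"
    define y where "y = 2 * pi * (k * j) / q"
    have angles: "2 * pi * m * real k / q = x - y" "2 * pi * n * real k / q = x + y"
      by (simp_all add: x_def y_def m_def n_def algebra_simps add_divide_distrib diff_divide_distrib)
    have "hartley q i k * hartley q k j = (cos x + sin x) * (cos y + sin y) / q"
      using q by (simp add: hartley_def x_def y_def)
    then show ?thesis
      unfolding angles by (simp add: cos_diff sin_add algebra_simps)
  qed
  have dvd: "int q dvd m \<longleftrightarrow> i = j"
  proof
    assume "int q dvd m"
    moreover have "\<bar>m\<bar> < int q"
      using assms by (simp add: m_def)
    ultimately show "i = j"
      using zdvd_imp_le[of "int q" "\<bar>m\<bar>"] by (cases "m = 0") (auto simp: m_def)
  qed (simp add: m_def)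
  have "(\<Sum>k<q. hartley q i k * hartley q k j) =
      (Re (\<Sum>k<q. cis (2 * pi * m * real k / q)) + Im (\<Sum>k<q. cis (2 * pi * n * real k / q))) / q"
    by (simp only: product sum_divide_distrib[symmetric] sum.distrib Re_sum Im_sum)
  also have "\<dots> = (if i = j then 1 else 0)"
    using q by (simp only: sum_cis_roots_of_unity dvd) simp
  finally show ?thesis .
qed

definition tree_words :: "nat \<Rightarrow> nat \<Rightarrow> nat list set" where
  "tree_words q n = {\<sigma> \<in> tree q. length \<sigma> = n}"

lemma tree_words_altdef: "tree_words q n = {\<sigma>. set \<sigma> \<subseteq> {..<q} \<and> length \<sigma> = n}"
  by (auto simp: tree_words_def tree_def)

lemma finite_tree_words [simp]: "finite (tree_words q n)"
  unfolding tree_words_altdef by (rule finite_lists_length_eq) simp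

lemma sum_tree_words_Suc:
  fixes g :: "nat list \<Rightarrow> 'a::comm_monoid_add"
  shows "(\<Sum>\<sigma>\<in>tree_words q (Suc n). g \<sigma>) = (\<Sum>i<q. \<Sum>\<sigma>\<in>tree_words q n. g (i # \<sigma>))"
proof -
  have words_Suc: "tree_words q (Suc n) = (\<lambda>(\<sigma>, i). i # \<sigma>) ` (tree_words q n \<times> {..<q})"
    unfolding tree_words_altdef by (rule lists_length_Suc_eq)
  have "(\<Sum>\<sigma>\<in>tree_words q (Suc n). g \<sigma>) = (\<Sum>(\<sigma>, i)\<in>tree_words q n \<times> {..<q}. g (i # \<sigma>))"
    unfolding words_Suc by (subst sum.reindex) (auto simp: inj_on_def intro!: sum.cong)
  also have "\<dots> = (\<Sum>i<q. \<Sum>\<sigma>\<in>tree_words q n. g (i # \<sigma>))"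
    by (subst sum.cartesian_product[symmetric]) (rule sum.swap)
  finally show ?thesis .
qed

text \<open>
  The tensor powers of the Hartley matrix, one for each level of the tree, extended by \<open>0\<close> to pairs of
  vertices of different levels.
\<close>

fun word_hartley :: "nat \<Rightarrow> nat list \<Rightarrow> nat list \<Rightarrow> real" where
  "word_hartley q [] [] = 1"
| "word_hartley q (i # \<sigma>) (j # \<tau>) = hartley q i j * word_hartley q \<sigma> \<tau>"
| "word_hartley q _ _ = 0"

lemma word_hartley_sym: "word_hartley q \<sigma> \<tau> = word_hartley q \<tau> \<sigma>"
  by (induction q \<sigma> \<tau> rule: word_hartley.induct) (simp_all add: hartley_sym)

lemma word_hartley_length: "length \<sigma> \<noteq> length \<tau> \<Longrightarrow> word_hartley q \<sigma> \<tau> = 0"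
  by (induction q \<sigma> \<tau> rule: word_hartley.induct) simp_all

lemma word_hartley_append:
  "length \<sigma> = length \<tau> \<Longrightarrow>
    word_hartley q (\<sigma> @ \<sigma>') (\<tau> @ \<tau>') = word_hartley q \<sigma> \<tau> * word_hartley q \<sigma>' \<tau>'"
  by (induction \<sigma> \<tau> rule: list_induct2) simp_all

lemma word_hartley_replicate_0:
  "word_hartley q \<rho> (replicate (length \<rho>) 0) = (1 / sqrt q) ^ length \<rho>"
  by (induction \<rho>) simp_all

lemma word_hartley_orthogonal:
  assumes "\<sigma> \<in> tree_words q n" "\<tau> \<in> tree_words q n"
  shows "(\<Sum>a\<in>tree_words q n. word_hartley q \<sigma> a * word_hartley q a \<tau>) = (if \<sigma> = \<tau> then 1 else 0)"
  using assms
proof (induction n arbitrary: \<sigma> \<tau>)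
  case 0
  have "tree_words q 0 = {[]}"
    by (auto simp: tree_words_altdef)
  with 0 show ?case
    by simp
next
  case (Suc n)
  from Suc.prems obtain i \<sigma>' where \<sigma>: "\<sigma> = i # \<sigma>'" "i < q" "\<sigma>' \<in> tree_words q n"
    by (cases \<sigma>) (auto simp: tree_words_altdef)
  from Suc.prems obtain j \<tau>' where \<tau>: "\<tau> = j # \<tau>'" "j < q" "\<tau>' \<in> tree_words q n"
    by (cases \<tau>) (auto simp: tree_words_altdef)
  have "(\<Sum>a\<in>tree_words q (Suc n). word_hartley q \<sigma> a * word_hartley q a \<tau>) =
      (\<Sum>k<q. \<Sum>a\<in>tree_words q n. (hartley q i k * hartley q k j) *
        (word_hartley q \<sigma>' a * word_hartley q a \<tau>'))"
    unfolding sum_tree_words_Suc by (simp add: \<sigma> \<tau> mult_ac)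
  also have "\<dots> = (\<Sum>k<q. hartley q i k * hartley q k j) *
      (\<Sum>a\<in>tree_words q n. word_hartley q \<sigma>' a * word_hartley q a \<tau>')"
    by (simp only: sum_product)
  also have "\<dots> = (if \<sigma> = \<tau> then 1 else 0)"
    by (simp add: hartley_orthogonal \<sigma> \<tau> Suc.IH)
  finally show ?case .
qed

definition hartley_transform :: "nat \<Rightarrow> (nat list \<Rightarrow> complex) \<Rightarrow> nat list \<Rightarrow> complex" where
  "hartley_transform q u \<sigma> =
     (if \<sigma> \<in> tree q then \<Sum>a\<in>tree_words q (length \<sigma>). of_real (word_hartley q \<sigma> a) * u a else 0)"

lemma hartley_transform_add:
  "hartley_transform q (u + v) = hartley_transform q u + hartley_transform q v"
  by (simp add: fun_eq_iff hartley_transform_def algebra_simps sum.distrib)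

lemma hartley_transform_scale:
  "hartley_transform q (cfun_scale c u) = cfun_scale c (hartley_transform q u)"
  by (simp add: fun_eq_iff hartley_transform_def cfun_scale_def sum_distrib_left mult_ac)

lemma hartley_transform_words:
  "\<sigma> \<in> tree_words q n \<Longrightarrow>
    hartley_transform q u \<sigma> = (\<Sum>a\<in>tree_words q n. of_real (word_hartley q \<sigma> a) * u a)"
  by (simp add: hartley_transform_def tree_words_def)

lemma hartley_transform_involution:
  assumes "\<And>\<sigma>. \<sigma> \<notin> tree q \<Longrightarrow> u \<sigma> = 0"
  shows "hartley_transform q (hartley_transform q u) = u"
proof
  fix \<sigma>
  show "hartley_transform q (hartley_transform q u) \<sigma> = u \<sigma>"
  proof (cases "\<sigma> \<in> tree q")
    case True
    define W where "W = tree_words q (length \<sigma>)"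
    have \<sigma>: "\<sigma> \<in> W"
      using True by (simp add: W_def tree_words_def)
    have "hartley_transform q (hartley_transform q u) \<sigma> =
        (\<Sum>a\<in>W. \<Sum>b\<in>W. of_real (word_hartley q \<sigma> a) * (of_real (word_hartley q a b) * u b))"
      using \<sigma> unfolding W_def by (simp add: hartley_transform_words sum_distrib_left)
    also have "\<dots> = (\<Sum>b\<in>W. (\<Sum>a\<in>W. of_real (word_hartley q \<sigma> a * word_hartley q a b)) * u b)"
      unfolding sum_distrib_right by (subst sum.swap) (intro sum.cong refl, simp)
    also have "\<dots> = (\<Sum>b\<in>W. if \<sigma> = b then u b else 0)"
      using \<sigma> unfolding W_def of_real_sum[symmetric]
      by (intro sum.cong refl) (simp add: word_hartley_orthogonal)
    also have "\<dots> = u \<sigma>"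
      using \<sigma> by (simp add: W_def)
    finally show ?thesis .
  qed (simp add: hartley_transform_def assms)
qed

lemma hartley_transform_level_norm:
  "(\<Sum>\<sigma>\<in>tree_words q n. (cmod (hartley_transform q u \<sigma>))\<^sup>2) = (\<Sum>\<sigma>\<in>tree_words q n. (cmod (u \<sigma>))\<^sup>2)"
proof -
  define W where "W = tree_words q n"
  have "complex_of_real (\<Sum>\<sigma>\<in>W. (cmod (hartley_transform q u \<sigma>))\<^sup>2) =
      (\<Sum>\<sigma>\<in>W. hartley_transform q u \<sigma> * cnj (hartley_transform q u \<sigma>))"
    by (simp only: of_real_sum complex_norm_square)
  also have "\<dots> = (\<Sum>\<sigma>\<in>W. \<Sum>a\<in>W. \<Sum>b\<in>W.
      of_real (word_hartley q a \<sigma> * word_hartley q \<sigma> b) * (u a * cnj (u b)))"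
    unfolding W_def
    by (intro sum.cong refl)
      (simp add: hartley_transform_words sum_product word_hartley_sym[of q _ "_"] mult_ac)
  also have "\<dots> = (\<Sum>a\<in>W. \<Sum>b\<in>W. \<Sum>\<sigma>\<in>W.
      of_real (word_hartley q a \<sigma> * word_hartley q \<sigma> b) * (u a * cnj (u b)))"
    by (subst sum.swap) (intro sum.cong refl sum.swap)
  also have "\<dots> = (\<Sum>a\<in>W. \<Sum>b\<in>W. (\<Sum>\<sigma>\<in>W.
      of_real (word_hartley q a \<sigma> * word_hartley q \<sigma> b)) * (u a * cnj (u b)))"
    by (simp only: sum_distrib_right)
  also have "\<dots> = (\<Sum>a\<in>W. \<Sum>b\<in>W. if a = b then u a * cnj (u b) else 0)"
    unfolding W_def of_real_sum[symmetric]
    by (intro sum.cong refl) (simp add: word_hartley_orthogonal)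
  also have "\<dots> = complex_of_real (\<Sum>\<sigma>\<in>W. (cmod (u \<sigma>))\<^sup>2)"
    by (simp add: W_def of_real_sum complex_norm_square del: of_real_power)
  finally show ?thesis
    unfolding W_def of_real_eq_iff .
qed

text \<open>
  Each level is mapped isometrically, and a finite set of vertices lies in finitely many levels; so
  the transform is a contraction. Being its own inverse, it is then an isometry.
\<close>

lemma hartley_transform_contraction:
  assumes u: "u \<in> ell2 (tree q)"
  shows "hartley_transform q u \<in> ell2 (tree q)"
    and "ell2_norm (tree q) (hartley_transform q u) \<le> ell2_norm (tree q) u"
proof -
  have bound: "(\<Sum>\<sigma>\<in>F. (cmod (hartley_transform q u \<sigma>))\<^sup>2) \<le> (ell2_norm (tree q) u)\<^sup>2"
    if F: "finite F" "F \<subseteq> tree q" for F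
  proof -
    define N where "N = length ` F"
    have N: "finite N"
      using F by (simp add: N_def)
    have disjoint: "\<forall>m\<in>N. \<forall>n\<in>N. m \<noteq> n \<longrightarrow> tree_words q m \<inter> tree_words q n = {}"
      by (auto simp: tree_words_def)
    have "(\<Sum>\<sigma>\<in>F. (cmod (hartley_transform q u \<sigma>))\<^sup>2) \<le>
        (\<Sum>\<sigma>\<in>(\<Union>n\<in>N. tree_words q n). (cmod (hartley_transform q u \<sigma>))\<^sup>2)"
    proof (rule sum_mono2)
      show "F \<subseteq> (\<Union>n\<in>N. tree_words q n)"
        using F by (auto simp: N_def tree_words_def)
    qed (use N in auto)
    also have "\<dots> = (\<Sum>n\<in>N. \<Sum>\<sigma>\<in>tree_words q n. (cmod (hartley_transform q u \<sigma>))\<^sup>2)"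
      using N disjoint by (intro sum.UNION_disjoint) auto
    also have "\<dots> = (\<Sum>n\<in>N. \<Sum>\<sigma>\<in>tree_words q n. (cmod (u \<sigma>))\<^sup>2)"
      by (simp only: hartley_transform_level_norm)
    also have "\<dots> = (\<Sum>\<sigma>\<in>(\<Union>n\<in>N. tree_words q n). (cmod (u \<sigma>))\<^sup>2)"
      using N disjoint by (intro sum.UNION_disjoint[symmetric]) auto
    also have "\<dots> \<le> (ell2_norm (tree q) u)\<^sup>2"
    proof (rule ell2_sum_le[OF u])
      show "(\<Union>n\<in>N. tree_words q n) \<subseteq> tree q"
        by (auto simp: tree_words_def)
    qed (use N in auto)
    finally show ?thesis .
  qed
  show "hartley_transform q u \<in> ell2 (tree q)"
    by (rule ell2I_bound(1)[OF _ ell2_norm_nonneg bound]) (simp_all add: hartley_transform_def)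
  show "ell2_norm (tree q) (hartley_transform q u) \<le> ell2_norm (tree q) u"
    by (rule ell2I_bound(2)[OF _ ell2_norm_nonneg bound]) (simp_all add: hartley_transform_def)
qed

lemma hartley_transform_ell2_involution:
  "u \<in> ell2 (tree q) \<Longrightarrow> hartley_transform q (hartley_transform q u) = u"
  by (rule hartley_transform_involution) (rule ell2_outside)

lemma hartley_transform_norm:
  assumes "u \<in> ell2 (tree q)"
  shows "ell2_norm (tree q) (hartley_transform q u) = ell2_norm (tree q) u"
  using hartley_transform_contraction(2)[OF assms]
    hartley_transform_contraction(2)[OF hartley_transform_contraction(1)[OF assms]]
  by (simp add: hartley_transform_ell2_involution[OF assms])


section \<open>Splitting off the trailing zeros of a word\<close>

text \<open>
  The label \<open>0\<close> belongs to the constant column of the Hartley matrix. After the transform, the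
  isometry that spreads the mass of a vertex evenly over its children therefore becomes the map that
  appends the letter \<open>0\<close>. Its orbits are indexed by the words that do not end in \<open>0\<close>, and on each
  orbit it is a copy of the unilateral shift.
\<close>

definition tree_stems :: "nat \<Rightarrow> nat list set" where
  "tree_stems q = {c \<in> tree q. c = [] \<or> last c \<noteq> 0}"

definition with_zeros :: "nat list \<Rightarrow> nat \<Rightarrow> nat list" where
  "with_zeros c n = c @ replicate n 0"

lemma with_zeros_tree: "0 < q \<Longrightarrow> c \<in> tree_stems q \<Longrightarrow> with_zeros c n \<in> tree q"
  by (simp add: with_zeros_def tree_stems_def tree_append_iff replicate_0_in_tree)

lemma with_zeros_cases:
  assumes "\<sigma> \<in> tree q"
  obtains c n where "c \<in> tree_stems q" "\<sigma> = with_zeros c n"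
proof -
  from assms have "\<exists>c\<in>tree_stems q. \<exists>n. \<sigma> = with_zeros c n"
  proof (induction \<sigma> rule: rev_induct)
    case Nil
    then show ?case
      by (auto simp: with_zeros_def tree_stems_def)
  next
    case (snoc i \<sigma>)
    show ?case
    proof (cases "i = 0")
      case True
      obtain c n where "c \<in> tree_stems q" "\<sigma> = with_zeros c n"
        using snoc by (auto simp: tree_append_iff)
      then have "\<sigma> @ [i] = with_zeros c (Suc n)"
        using True by (simp add: with_zeros_def replicate_append_same)
      then show ?thesis
        using \<open>c \<in> tree_stems q\<close> by blast
    next
      case False
      then have "\<sigma> @ [i] \<in> tree_stems q" "\<sigma> @ [i] = with_zeros (\<sigma> @ [i]) 0"
        using snoc.prems by (auto simp: with_zeros_def tree_stems_def)
      then show ?thesis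
        by blast
    qed
  qed
  then show thesis
    using that by blast
qed

lemma with_zeros_inject:
  assumes "c \<in> tree_stems q" "d \<in> tree_stems q" "with_zeros c m = with_zeros d n"
  shows "c = d \<and> m = n"
proof -
  have le: "m \<le> n" if d: "d \<in> tree_stems q" and eq: "with_zeros c m = with_zeros d n" for c d m n
  proof (rule ccontr)
    assume "\<not> m \<le> n"
    then have "with_zeros c m = c @ replicate (m - n) 0 @ replicate n 0"
      by (simp add: with_zeros_def flip: replicate_add)
    then have "d = c @ replicate (m - n) 0"
      using eq by (simp add: with_zeros_def)
    then show False
      using d \<open>\<not> m \<le> n\<close> by (simp add: tree_stems_def)
  qed
  have "m = n"
    using le[OF assms(2,3)] le[OF assms(1) assms(3)[symmetric]] by simp
  then show ?thesis
    using assms(3) by (simp add: with_zeros_def)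
qed

lemma bij_betw_with_zeros:
  assumes "0 < q"
  shows "bij_betw (\<lambda>(c, n). with_zeros c n) (tree_stems q \<times> UNIV) (tree q)"
  unfolding bij_betw_def
proof
  show "inj_on (\<lambda>(c, n). with_zeros c n) (tree_stems q \<times> UNIV)"
    using with_zeros_inject by (fastforce simp: inj_on_def)
  show "(\<lambda>(c, n). with_zeros c n) ` (tree_stems q \<times> UNIV) = tree q"
  proof
    show "(\<lambda>(c, n). with_zeros c n) ` (tree_stems q \<times> UNIV) \<subseteq> tree q"
      using with_zeros_tree[OF assms] by auto
    show "tree q \<subseteq> (\<lambda>(c, n). with_zeros c n) ` (tree_stems q \<times> UNIV)"
    proof
      fix \<sigma> assume "\<sigma> \<in> tree q"
      then obtain c n where "c \<in> tree_stems q" "\<sigma> = with_zeros c n"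
        by (rule with_zeros_cases)
      then show "\<sigma> \<in> (\<lambda>(c, n). with_zeros c n) ` (tree_stems q \<times> UNIV)"
        by force
    qed
  qed
qed

lemma infinite_tree_stems:
  assumes "2 \<le> q"
  shows "infinite (tree_stems q)"
proof -
  have "range (\<lambda>n. replicate n 0 @ [1]) \<subseteq> tree_stems q"
    using assms by (auto simp: tree_stems_def tree_def)
  moreover have "inj (\<lambda>n. replicate n (0::nat) @ [1])"
    by (rule injI) (metis length_replicate append_same_eq)
  then have "infinite (range (\<lambda>n. replicate n (0::nat) @ [1]))"
    by (rule range_inj_infinite)
  ultimately show ?thesis
    using finite_subset by blast
qed

definition stem_coordinate :: "nat \<Rightarrow> nat list \<Rightarrow> (nat list \<Rightarrow> complex) \<Rightarrow> nat \<Rightarrow> complex" where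
  "stem_coordinate q c u = (\<lambda>n. hartley_transform q u (with_zeros c n))"

text \<open>
  The transform is unitary, and the words are the disjoint union of the orbits; so sorting the values
  of the transform by orbits gives an orthogonal decomposition.
\<close>

theorem infinite_ell2_decomposition_tree:
  assumes q: "2 \<le> q"
  shows "infinite_ell2_decomposition (tree q) (tree_stems q) UNIV (stem_coordinate q)"
proof
  have q0: "0 < q"
    using q by simp
  note bij = bij_betw_with_zeros[OF q0]
  show "stem_coordinate q c (u + v) = stem_coordinate q c u + stem_coordinate q c v" for c u v
    by (simp add: stem_coordinate_def hartley_transform_add fun_eq_iff)
  show "stem_coordinate q c (cfun_scale k u) = cfun_scale k (stem_coordinate q c u)" for c k u
    unfolding stem_coordinate_def hartley_transform_scale by (simp add: cfun_scale_def)
  have sum: "((\<lambda>(c, n). (cmod (stem_coordinate q c u n))\<^sup>2) has_sum (ell2_norm (tree q) u)\<^sup>2)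
      (tree_stems q \<times> UNIV)" if "u \<in> ell2 (tree q)" for u
    using ell2_has_sum[OF hartley_transform_contraction(1)[OF that]]
    unfolding hartley_transform_norm[OF that] has_sum_reindex_bij_betw[OF bij, symmetric]
    by (simp add: stem_coordinate_def case_prod_unfold)
  show coord: "stem_coordinate q c u \<in> ell2 UNIV" if "c \<in> tree_stems q" "u \<in> ell2 (tree q)" for c u
    using summable_on_SigmaD1[OF has_sum_imp_summable[OF sum[OF that(2)]] that(1)]
    by (simp add: ell2_def)
  show "((\<lambda>c. (ell2_norm UNIV (stem_coordinate q c u))\<^sup>2) has_sum (ell2_norm (tree q) u)\<^sup>2) (tree_stems q)"
    if "u \<in> ell2 (tree q)" for u
    by (rule has_sum_SigmaD[OF sum[OF that]]) (use ell2_has_sum[OF coord[OF _ that]] in simp)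
  show "\<exists>u\<in>ell2 (tree q). \<forall>c\<in>tree_stems q. stem_coordinate q c u = w c"
    if w: "\<And>c. c \<in> tree_stems q \<Longrightarrow> w c \<in> ell2 UNIV"
      and summable: "(\<lambda>c. (ell2_norm UNIV (w c))\<^sup>2) summable_on tree_stems q" for w
  proof -
    define split where "split = inv_into (tree_stems q \<times> UNIV) (\<lambda>(c, n). with_zeros c n)"
    define v where "v \<sigma> = (if \<sigma> \<in> tree q then w (fst (split \<sigma>)) (snd (split \<sigma>)) else 0)" for \<sigma>
    have v: "v (with_zeros c n) = w c n" if "c \<in> tree_stems q" for c n
    proof -
      have "split (with_zeros c n) = (c, n)"
        using bij_betw_inv_into_left[OF bij, of "(c, n)"] that by (simp add: split_def)
      then show ?thesis
        using with_zeros_tree[OF q0 that] by (simp add: v_def)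
    qed
    have "(\<lambda>(c, n). (cmod (w c n))\<^sup>2) summable_on (tree_stems q \<times> UNIV)"
      by (rule summable_on_SigmaI[OF _ summable]) (use ell2_has_sum[OF w] in auto)
    then have "(\<lambda>x. (cmod (v (case x of (c, n) \<Rightarrow> with_zeros c n)))\<^sup>2) summable_on (tree_stems q \<times> UNIV)"
      by (rule summable_on_cong[THEN iffD1, rotated]) (auto simp: v)
    then have "(\<lambda>\<sigma>. (cmod (v \<sigma>))\<^sup>2) summable_on tree q"
      using summable_on_reindex_bij_betw[OF bij, of "\<lambda>\<sigma>. (cmod (v \<sigma>))\<^sup>2"] by simp
    then have v_ell2: "v \<in> ell2 (tree q)"
      by (simp add: ell2_def v_def)
    then have "stem_coordinate q c (hartley_transform q v) = w c" if "c \<in> tree_stems q" for c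
      using that by (simp add: stem_coordinate_def hartley_transform_ell2_involution v)
    then show ?thesis
      using hartley_transform_contraction(1)[OF v_ell2] by blast
  qed
  show "infinite (tree_stems q)"
    by (rule infinite_tree_stems[OF q])
qed


section \<open>Bessel's inequality and the boundedness of Toeplitz operators\<close>

abbreviation circle_measure :: "real measure" where
  "circle_measure \<equiv> lebesgue_on {0..2*pi}"

definition bounded_on_circle :: "(real \<Rightarrow> complex) \<Rightarrow> bool" where
  "bounded_on_circle g \<longleftrightarrow>
     g \<in> borel_measurable circle_measure \<and> (\<exists>K. AE \<theta> in circle_measure. cmod (g \<theta>) \<le> K)"

lemma fourier_coeff_cis:
  "fourier_coeff f n = (LINT \<theta>|circle_measure. f (cis \<theta>) * cis (- of_int n * \<theta>)) / (2 * of_real pi)"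
proof -
  have "exp (- \<i> * of_int n * of_real \<theta>) = cis (- of_int n * \<theta>)" for \<theta>
    by (simp add: cis_conv_exp mult_ac)
  then show ?thesis
    by (simp only: fourier_coeff_def)
qed

lemma Linf_circle_iff: "f \<in> Linf_circle \<longleftrightarrow> bounded_on_circle (\<lambda>\<theta>. f (cis \<theta>))"
  by (simp add: Linf_circle_def bounded_on_circle_def)

lemma finite_circle_measure: "finite_measure circle_measure"
  by (rule finite_measure_lebesgue_on) (simp add: lmeasurable_interval)

lemma integrable_if_bounded_on_circle: "bounded_on_circle g \<Longrightarrow> integrable circle_measure g"
  unfolding bounded_on_circle_def
  using finite_measure.integrable_const_bound[OF finite_circle_measure] by blast

lemma bounded_on_circle_const: "bounded_on_circle (\<lambda>\<theta>. c)"
  unfolding bounded_on_circle_def by (auto intro!: exI[of _ "cmod c"])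

lemma bounded_on_circle_add:
  assumes "bounded_on_circle g" "bounded_on_circle h"
  shows "bounded_on_circle (\<lambda>\<theta>. g \<theta> + h \<theta>)"
proof -
  obtain K L where K: "AE \<theta> in circle_measure. cmod (g \<theta>) \<le> K"
      and L: "AE \<theta> in circle_measure. cmod (h \<theta>) \<le> L"
    using assms by (auto simp: bounded_on_circle_def)
  have "AE \<theta> in circle_measure. cmod (g \<theta> + h \<theta>) \<le> K + L"
    using K L by eventually_elim (rule norm_triangle_mono)
  moreover have "(\<lambda>\<theta>. g \<theta> + h \<theta>) \<in> borel_measurable circle_measure"
    using assms by (auto simp: bounded_on_circle_def)
  ultimately show ?thesis
    by (auto simp: bounded_on_circle_def)
qed

lemma bounded_on_circle_mult:
  assumes "bounded_on_circle g" "bounded_on_circle h"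
  shows "bounded_on_circle (\<lambda>\<theta>. g \<theta> * h \<theta>)"
proof -
  obtain K L where K: "AE \<theta> in circle_measure. cmod (g \<theta>) \<le> K"
      and L: "AE \<theta> in circle_measure. cmod (h \<theta>) \<le> L"
    using assms by (auto simp: bounded_on_circle_def)
  have "AE \<theta> in circle_measure. cmod (g \<theta> * h \<theta>) \<le> \<bar>K\<bar> * \<bar>L\<bar>"
    using K L
  proof eventually_elim
    case (elim \<theta>)
    then show ?case
      unfolding norm_mult by (intro mult_mono) auto
  qed
  moreover have "(\<lambda>\<theta>. g \<theta> * h \<theta>) \<in> borel_measurable circle_measure"
    using assms by (auto simp: bounded_on_circle_def)
  ultimately show ?thesis
    by (auto simp: bounded_on_circle_def)
qed

lemma bounded_on_circle_cnj:
  assumes "bounded_on_circle g"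
  shows "bounded_on_circle (\<lambda>\<theta>. cnj (g \<theta>))"
proof -
  have "(\<lambda>\<theta>. cnj (g \<theta>)) \<in> borel_measurable circle_measure"
    using assms unfolding bounded_on_circle_def
    by (intro borel_measurable_continuous_on[of cnj, OF _]) (auto intro: continuous_intros)
  then show ?thesis
    using assms by (auto simp: bounded_on_circle_def)
qed

lemma bounded_on_circle_diff:
  assumes "bounded_on_circle g" "bounded_on_circle h"
  shows "bounded_on_circle (\<lambda>\<theta>. g \<theta> - h \<theta>)"
  using bounded_on_circle_add[OF assms(1) bounded_on_circle_mult[OF bounded_on_circle_const[of "-1"] assms(2)]]
  by simp

lemma bounded_on_circle_sum:
  assumes "\<And>i. i \<in> I \<Longrightarrow> bounded_on_circle (g i)"
  shows "bounded_on_circle (\<lambda>\<theta>. \<Sum>i\<in>I. g i \<theta>)"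
  using assms
  by (induction I rule: infinite_finite_induct) (simp_all add: bounded_on_circle_const bounded_on_circle_add)

lemma bounded_on_circle_cis: "bounded_on_circle (\<lambda>\<theta>. cis (a * \<theta>))"
proof -
  have "(\<lambda>\<theta>. cis (a * \<theta>)) \<in> borel_measurable circle_measure"
    by (intro continuous_imp_measurable_on_sets_lebesgue continuous_intros) auto
  then show ?thesis
    unfolding bounded_on_circle_def by (auto intro!: exI[of _ 1])
qed

lemmas bounded_on_circle_intros =
  bounded_on_circle_const bounded_on_circle_add bounded_on_circle_diff bounded_on_circle_mult
  bounded_on_circle_cnj bounded_on_circle_sum bounded_on_circle_cis

lemma integral_cis_circle:
  "(LINT \<theta>|circle_measure. cis (of_int k * \<theta>)) = (if k = 0 then 2 * of_real pi else 0)"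
proof -
  have "(LINT \<theta>|circle_measure. cis (of_int k * \<theta>)) = integral {0..2*pi} (\<lambda>\<theta>. cis (of_int k * \<theta>))"
    by (intro lebesgue_integral_eq_integral integrable_if_bounded_on_circle bounded_on_circle_cis) simp
  also have "\<dots> = (if k = 0 then 2 * of_real pi else 0)"
  proof (cases "k = 0")
    case True
    then show ?thesis
      by (simp add: scaleR_conv_of_real)
  next
    case False
    have "((\<lambda>\<theta>. cis (of_int k * \<theta>)) has_integral
        (cis (of_int k * (2 * pi)) / (\<i> * of_int k) - cis (of_int k * 0) / (\<i> * of_int k))) {0..2*pi}"
    proof (rule fundamental_theorem_of_calculus)
      fix x :: real
      show "((\<lambda>\<theta>. cis (of_int k * \<theta>) / (\<i> * of_int k)) has_vector_derivative cis (of_int k * x))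
          (at x within {0..2 * pi})"
        using False unfolding has_vector_derivative_def
        by (auto intro!: derivative_eq_intros simp: scaleR_conv_of_real field_simps)
    qed simp
    moreover have "cis (of_int k * (2 * pi)) = 1"
      using cis_multiple_2pi[of "of_int k"] by (simp add: mult.commute)
    ultimately show ?thesis
      using False by (simp add: integral_unique)
  qed
  finally show ?thesis .
qed

lemma parseval_trig_polynomial:
  assumes F: "finite (F :: int set)"
  shows "(LINT \<theta>|circle_measure. (\<Sum>k\<in>F. c k * cis (of_int k * \<theta>)) * cnj (\<Sum>k\<in>F. c k * cis (of_int k * \<theta>)))
    = of_real (2 * pi * (\<Sum>k\<in>F. (cmod (c k))\<^sup>2))"
proof -
  have "(LINT \<theta>|circle_measure. (\<Sum>k\<in>F. c k * cis (of_int k * \<theta>)) * cnj (\<Sum>k\<in>F. c k * cis (of_int k * \<theta>)))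
      = (LINT \<theta>|circle_measure. (\<Sum>k\<in>F. \<Sum>l\<in>F. (c k * cnj (c l)) * cis (of_int (k - l) * \<theta>)))"
  proof (rule Bochner_Integration.integral_cong[OF refl])
    fix \<theta>
    have "c k * cis (of_int k * \<theta>) * cnj (c l * cis (of_int l * \<theta>)) =
        (c k * cnj (c l)) * cis (of_int (k - l) * \<theta>)" for k l
    proof -
      have "cis (of_int (k - l) * \<theta>) = cis (of_int k * \<theta>) * cnj (cis (of_int l * \<theta>))"
        by (simp add: cis_cnj cis_mult algebra_simps)
      then show ?thesis
        by simp
    qed
    then show "(\<Sum>k\<in>F. c k * cis (of_int k * \<theta>)) * cnj (\<Sum>k\<in>F. c k * cis (of_int k * \<theta>)) =
        (\<Sum>k\<in>F. \<Sum>l\<in>F. (c k * cnj (c l)) * cis (of_int (k - l) * \<theta>))"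
      by (simp only: cnj_sum sum_product)
  qed
  also have "\<dots> = (\<Sum>k\<in>F. LINT \<theta>|circle_measure. (\<Sum>l\<in>F. (c k * cnj (c l)) * cis (of_int (k - l) * \<theta>)))"
    by (intro Bochner_Integration.integral_sum integrable_if_bounded_on_circle bounded_on_circle_intros)
  also have "\<dots> = (\<Sum>k\<in>F. \<Sum>l\<in>F. LINT \<theta>|circle_measure. (c k * cnj (c l)) * cis (of_int (k - l) * \<theta>))"
    by (intro sum.cong refl Bochner_Integration.integral_sum integrable_if_bounded_on_circle
        bounded_on_circle_intros)
  also have "\<dots> = (\<Sum>k\<in>F. \<Sum>l\<in>F. if k = l then 2 * of_real pi * (c k * cnj (c k)) else 0)"
    by (intro sum.cong refl)
      (auto simp: integral_cis_circle simp del: of_int_diff)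
  also have "\<dots> = (\<Sum>k\<in>F. 2 * of_real pi * (c k * cnj (c k)))"
    using F by simp
  also have "\<dots> = of_real (2 * pi * (\<Sum>k\<in>F. (cmod (c k))\<^sup>2))"
    by (simp add: sum_distrib_left complex_norm_square del: of_real_power)
  finally show ?thesis .
qed

text \<open>
  The squared distance in \<open>L\<^sup>2\<close> from \<open>g\<close> to its orthogonal projection \<open>p\<close> onto the span of the
  exponentials with frequencies in \<open>F\<close> is the difference of the two sides, up to a factor.
\<close>

lemma bessel_inequality:
  assumes F: "finite (F :: int set)" and g: "bounded_on_circle g"
  shows "(\<Sum>k\<in>F. (cmod (LINT \<theta>|circle_measure. g \<theta> * cis (- of_int k * \<theta>)))\<^sup>2)
    \<le> 2 * pi * (LINT \<theta>|circle_measure. (cmod (g \<theta>))\<^sup>2)"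
proof -
  define I where "I k = (LINT \<theta>|circle_measure. g \<theta> * cis (- of_int k * \<theta>))" for k :: int
  define c where "c k = I k / (2 * pi)" for k
  define p where "p \<theta> = (\<Sum>k\<in>F. c k * cis (of_int k * \<theta>))" for \<theta>
  define s where "s = (\<Sum>k\<in>F. (cmod (c k))\<^sup>2)"
  have p: "bounded_on_circle p"
    unfolding p_def by (intro bounded_on_circle_intros)
  have pp: "(LINT \<theta>|circle_measure. p \<theta> * cnj (p \<theta>)) = of_real (2 * pi * s)"
    unfolding p_def s_def by (rule parseval_trig_polynomial[OF F])
  have "(LINT \<theta>|circle_measure. g \<theta> * cnj (p \<theta>)) =
      (LINT \<theta>|circle_measure. (\<Sum>k\<in>F. cnj (c k) * (g \<theta> * cis (- of_int k * \<theta>))))"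
    by (intro Bochner_Integration.integral_cong refl)
      (simp add: p_def cis_cnj sum_distrib_left mult_ac)
  also have "\<dots> = (\<Sum>k\<in>F. LINT \<theta>|circle_measure. cnj (c k) * (g \<theta> * cis (- of_int k * \<theta>)))"
    by (intro Bochner_Integration.integral_sum integrable_if_bounded_on_circle bounded_on_circle_intros g)
  also have "\<dots> = (\<Sum>k\<in>F. cnj (c k) * I k)"
    by (simp add: I_def)
  also have "\<dots> = of_real (2 * pi * s)"
  proof -
    have "cnj (c k) * I k = of_real (2 * pi * (cmod (c k))\<^sup>2)" for k
    proof -
      have "I k = of_real (2 * pi) * c k"
        by (simp add: c_def)
      then show ?thesis
        by (simp add: complex_norm_square mult_ac del: of_real_power)
    qed
    then show ?thesis
      unfolding s_def by (simp only: sum_distrib_left of_real_sum)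
  qed
  finally have gp: "(LINT \<theta>|circle_measure. g \<theta> * cnj (p \<theta>)) = of_real (2 * pi * s)" .
  have "p \<theta> * cnj (g \<theta>) = cnj (g \<theta> * cnj (p \<theta>))" for \<theta>
    by simp
  then have pg: "(LINT \<theta>|circle_measure. p \<theta> * cnj (g \<theta>)) = of_real (2 * pi * s)"
    by (simp only: Bochner_Integration.integral_cnj gp complex_cnj_complex_of_real)
  have "complex_of_real (LINT \<theta>|circle_measure. (cmod (g \<theta> - p \<theta>))\<^sup>2) =
      (LINT \<theta>|circle_measure. complex_of_real ((cmod (g \<theta> - p \<theta>))\<^sup>2))"
    by (rule integral_complex_of_real[symmetric])
  also have "\<dots> = (LINT \<theta>|circle_measure.
      (g \<theta> * cnj (g \<theta>) - g \<theta> * cnj (p \<theta>)) - (p \<theta> * cnj (g \<theta>) - p \<theta> * cnj (p \<theta>)))"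
    unfolding complex_norm_square by (simp add: algebra_simps)
  also have "\<dots> = ((LINT \<theta>|circle_measure. g \<theta> * cnj (g \<theta>)) - (LINT \<theta>|circle_measure. g \<theta> * cnj (p \<theta>)))
      - ((LINT \<theta>|circle_measure. p \<theta> * cnj (g \<theta>)) - (LINT \<theta>|circle_measure. p \<theta> * cnj (p \<theta>)))"
    by (simp add: integrable_if_bounded_on_circle bounded_on_circle_intros g p)
  also have "(LINT \<theta>|circle_measure. g \<theta> * cnj (g \<theta>)) = of_real (LINT \<theta>|circle_measure. (cmod (g \<theta>))\<^sup>2)"
    unfolding complex_norm_square[symmetric] by (rule integral_complex_of_real)
  finally have "(LINT \<theta>|circle_measure. (cmod (g \<theta> - p \<theta>))\<^sup>2) =
      (LINT \<theta>|circle_measure. (cmod (g \<theta>))\<^sup>2) - 2 * pi * s"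
    unfolding gp pg pp of_real_diff[symmetric] of_real_eq_iff by simp
  moreover have "0 \<le> (LINT \<theta>|circle_measure. (cmod (g \<theta> - p \<theta>))\<^sup>2)"
    by simp
  ultimately have "2 * pi * s \<le> (LINT \<theta>|circle_measure. (cmod (g \<theta>))\<^sup>2)"
    by simp
  then have "2 * pi * (2 * pi * s) \<le> 2 * pi * (LINT \<theta>|circle_measure. (cmod (g \<theta>))\<^sup>2)"
    by (intro mult_left_mono) auto
  moreover have "(\<Sum>k\<in>F. (cmod (I k))\<^sup>2) = 2 * pi * (2 * pi * s)"
    by (simp add: s_def c_def norm_divide power_divide power2_eq_square sum_distrib_left)
  ultimately show ?thesis
    unfolding I_def by simp
qed

text \<open>
  On a finitely supported \<open>u\<close> the Toeplitz matrix computes Fourier coefficients of the product of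
  \<open>f\<close> with the trigonometric polynomial with coefficients \<open>u\<close>; multiplication by \<open>f\<close> is bounded
  on \<open>L\<^sup>2\<close>, and Bessel's inequality estimates the coefficients.
\<close>

lemma toeplitz_finite_section_bound:
  assumes "f \<in> Linf_circle"
  obtains K where "0 \<le> K" "\<And>F G u. \<lbrakk>finite F; finite G\<rbrakk> \<Longrightarrow>
    (\<Sum>k\<in>F. (cmod (\<Sum>l\<in>G. fourier_coeff f (int k - int l) * u l))\<^sup>2) \<le> K\<^sup>2 * (\<Sum>l\<in>G. (cmod (u l))\<^sup>2)"
proof -
  have f: "bounded_on_circle (\<lambda>\<theta>. f (cis \<theta>))"
    using assms by (simp add: Linf_circle_iff)
  then obtain K0 where K0: "AE \<theta> in circle_measure. cmod (f (cis \<theta>)) \<le> K0"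
    by (auto simp: bounded_on_circle_def)
  define K where "K = \<bar>K0\<bar>"
  have K: "AE \<theta> in circle_measure. cmod (f (cis \<theta>)) \<le> K" "0 \<le> K"
    using K0 by (auto simp: K_def elim: eventually_mono)
  show thesis
  proof (rule that[OF K(2)])
    fix F G :: "nat set" and u :: "nat \<Rightarrow> complex"
    assume F: "finite F" and G: "finite G"
    define p where "p \<theta> = (\<Sum>l\<in>G. u l * cis (of_int (int l) * \<theta>))" for \<theta>
    have p: "bounded_on_circle p"
      unfolding p_def by (intro bounded_on_circle_intros)
    define g where "g \<theta> = f (cis \<theta>) * p \<theta>" for \<theta>
    have g: "bounded_on_circle g"
      unfolding g_def by (intro bounded_on_circle_mult f p)
    have coeff: "(LINT \<theta>|circle_measure. g \<theta> * cis (- of_int (int k) * \<theta>)) =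
        2 * pi * (\<Sum>l\<in>G. fourier_coeff f (int k - int l) * u l)" for k
    proof -
      have "(LINT \<theta>|circle_measure. g \<theta> * cis (- of_int (int k) * \<theta>)) =
          (LINT \<theta>|circle_measure. (\<Sum>l\<in>G. u l * (f (cis \<theta>) * cis (- of_int (int k - int l) * \<theta>))))"
      proof (rule Bochner_Integration.integral_cong[OF refl])
        fix \<theta>
        have "cis (- of_int (int k - int l) * \<theta>) = cis (of_int (int l) * \<theta>) * cis (- of_int (int k) * \<theta>)"
          for l
          by (simp add: cis_mult algebra_simps)
        then show "g \<theta> * cis (- of_int (int k) * \<theta>) =
            (\<Sum>l\<in>G. u l * (f (cis \<theta>) * cis (- of_int (int k - int l) * \<theta>)))"
          by (simp add: g_def p_def sum_distrib_left sum_distrib_right mult_ac)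
      qed
      also have "\<dots> = (\<Sum>l\<in>G. LINT \<theta>|circle_measure. u l * (f (cis \<theta>) * cis (- of_int (int k - int l) * \<theta>)))"
        by (intro Bochner_Integration.integral_sum integrable_if_bounded_on_circle bounded_on_circle_intros f)
      also have "\<dots> = (\<Sum>l\<in>G. 2 * pi * (fourier_coeff f (int k - int l) * u l))"
      proof (rule sum.cong[OF refl])
        fix l
        show "(LINT \<theta>|circle_measure. u l * (f (cis \<theta>) * cis (- of_int (int k - int l) * \<theta>))) =
            2 * pi * (fourier_coeff f (int k - int l) * u l)"
          unfolding fourier_coeff_cis by simp
      qed
      finally show ?thesis
        by (simp add: sum_distrib_left)
    qed
    have coeff_square: "(cmod (LINT \<theta>|circle_measure. g \<theta> * cis (- (real k * \<theta>))))\<^sup>2 =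
        (2 * pi)\<^sup>2 * (cmod (\<Sum>l\<in>G. fourier_coeff f (int k - int l) * u l))\<^sup>2" for k
      using coeff[of k, THEN arg_cong, of cmod] by (simp add: norm_mult power_mult_distrib)
    have "complex_of_real (LINT \<theta>|circle_measure. (cmod (p \<theta>))\<^sup>2) =
        (LINT \<theta>|circle_measure. p \<theta> * cnj (p \<theta>))"
      unfolding complex_norm_square[symmetric] by (rule integral_complex_of_real[symmetric])
    also have "\<dots> = of_real (2 * pi * (\<Sum>l\<in>G. (cmod (u l))\<^sup>2))"
      using parseval_trig_polynomial[of "int ` G" "\<lambda>l. u (nat l)"] G
      by (simp add: p_def sum.reindex)
    finally have norm_p: "(LINT \<theta>|circle_measure. (cmod (p \<theta>))\<^sup>2) = 2 * pi * (\<Sum>l\<in>G. (cmod (u l))\<^sup>2)"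
      unfolding of_real_eq_iff .
    have square: "integrable circle_measure (\<lambda>\<theta>. (cmod (h \<theta>))\<^sup>2)" if "bounded_on_circle h" for h
    proof -
      have "integrable circle_measure (\<lambda>\<theta>. Re (h \<theta> * cnj (h \<theta>)))"
        by (intro integrable_Re integrable_if_bounded_on_circle bounded_on_circle_intros that)
      then show ?thesis
        by (simp flip: complex_norm_square)
    qed
    have "(2 * pi)\<^sup>2 * (\<Sum>k\<in>F. (cmod (\<Sum>l\<in>G. fourier_coeff f (int k - int l) * u l))\<^sup>2) =
        (\<Sum>k\<in>int ` F. (cmod (LINT \<theta>|circle_measure. g \<theta> * cis (- of_int k * \<theta>)))\<^sup>2)"
      by (simp add: sum.reindex coeff_square sum_distrib_left)
    also have "\<dots> \<le> 2 * pi * (LINT \<theta>|circle_measure. (cmod (g \<theta>))\<^sup>2)"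
      by (rule bessel_inequality[OF _ g]) (use F in simp)
    also have "\<dots> \<le> 2 * pi * (LINT \<theta>|circle_measure. K\<^sup>2 * (cmod (p \<theta>))\<^sup>2)"
    proof (intro mult_left_mono integral_mono_AE square g integrable_mult_right p)
      show "AE \<theta> in circle_measure. (cmod (g \<theta>))\<^sup>2 \<le> K\<^sup>2 * (cmod (p \<theta>))\<^sup>2"
        using K(1)
      proof eventually_elim
        case (elim \<theta>)
        then show ?case
          unfolding g_def norm_mult power_mult_distrib by (intro mult_right_mono power_mono) auto
      qed
    qed auto
    also have "\<dots> = 2 * pi * (K\<^sup>2 * (2 * pi * (\<Sum>l\<in>G. (cmod (u l))\<^sup>2)))"
      by (simp add: norm_p)
    also have "\<dots> = (2 * pi)\<^sup>2 * (K\<^sup>2 * (\<Sum>l\<in>G. (cmod (u l))\<^sup>2))"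
      unfolding power2_eq_square[of "2 * pi"] by (simp only: mult_ac)
    finally show "(\<Sum>k\<in>F. (cmod (\<Sum>l\<in>G. fourier_coeff f (int k - int l) * u l))\<^sup>2)
        \<le> K\<^sup>2 * (\<Sum>l\<in>G. (cmod (u l))\<^sup>2)"
      by simp
  qed
qed

lemma toeplitz_operator:
  assumes "f \<in> Linf_circle"
  shows "bounded_operator UNIV (toeplitz_operator f)"
    and "toeplitz_operator f (indicator {l}) k = fourier_coeff f (int k - int l)"
proof -
  obtain K where K: "0 \<le> K" "\<And>F G u. \<lbrakk>finite F; finite G\<rbrakk> \<Longrightarrow>
      (\<Sum>k\<in>F. (cmod (\<Sum>l\<in>G. fourier_coeff f (int k - int l) * u l))\<^sup>2) \<le> K\<^sup>2 * (\<Sum>l\<in>G. (cmod (u l))\<^sup>2)"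
    by (rule toeplitz_finite_section_bound[OF assms]) blast
  obtain T where T: "bounded_operator UNIV T"
      "has_kernel UNIV T (\<lambda>k l. fourier_coeff f (int k - int l))"
    using kernel_operator_exists[OF K(1), of UNIV "\<lambda>k l. fourier_coeff f (int k - int l)"] K(2) by blast
  have eq: "toeplitz_operator f = T"
    unfolding toeplitz_operator_def by (rule kernel_operator_eqI[OF T])
  show "bounded_operator UNIV (toeplitz_operator f)"
    using T(1) by (simp add: eq)
  show "toeplitz_operator f (indicator {l}) k = fourier_coeff f (int k - int l)"
    using T(2) by (simp add: eq has_kernel_def ell2_inner_indicator)
qed


section \<open>The tree operator as an orthogonal sum of Toeplitz operators\<close>

lemma hartley_transform_indicator:
  assumes "\<tau> \<in> tree q"
  shows "hartley_transform q (indicator {\<tau>}) \<sigma> =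
    (if \<sigma> \<in> tree q then of_real (word_hartley q \<sigma> \<tau>) else 0)"
proof (cases "length \<sigma> = length \<tau>")
  case True
  have "hartley_transform q (indicator {\<tau>}) \<sigma> =
      (if \<sigma> \<in> tree q then \<Sum>a\<in>tree_words q (length \<tau>). if a = \<tau> then of_real (word_hartley q \<sigma> a) else 0 else 0)"
    by (auto simp: hartley_transform_def True indicator_def intro!: sum.cong)
  moreover have "\<tau> \<in> tree_words q (length \<tau>)"
    using assms by (simp add: tree_words_def)
  ultimately show ?thesis
    by simp
next
  case False
  have "(\<Sum>a\<in>tree_words q (length \<sigma>). of_real (word_hartley q \<sigma> a) * indicator {\<tau>} a) = (0::complex)"
    by (rule sum.neutral) (use False in \<open>auto simp: tree_words_def indicator_def\<close>)
  then show ?thesis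
    by (simp add: hartley_transform_def word_hartley_length[OF False])
qed

text \<open>
  The transform of a basis vector lives on one level, which each orbit meets at most once. Hence every
  coordinate of a basis vector is a multiple of a basis vector of \<open>\<ell>\<^sup>2(\<nat>)\<close>, and the Toeplitz operator
  enters the columns of the ampliation through single matrix entries.
\<close>

lemma stem_coordinate_indicator:
  assumes "0 < q" "c \<in> tree_stems q" "\<tau> \<in> tree q"
  shows "stem_coordinate q c (indicator {\<tau>}) =
    (if length c \<le> length \<tau>
     then cfun_scale (of_real (word_hartley q (with_zeros c (length \<tau> - length c)) \<tau>))
       (indicator {length \<tau> - length c})
     else 0)"
proof
  fix n
  have len: "length (with_zeros c n) = length c + n"
    by (simp add: with_zeros_def)
  have "stem_coordinate q c (indicator {\<tau>}) n = of_real (word_hartley q (with_zeros c n) \<tau>)"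
    by (simp add: stem_coordinate_def hartley_transform_indicator assms with_zeros_tree)
  also have "word_hartley q (with_zeros c n) \<tau> = 0" if "length c + n \<noteq> length \<tau>"
    by (rule word_hartley_length) (use that len in simp)
  then have "complex_of_real (word_hartley q (with_zeros c n) \<tau>) =
      (if length c \<le> length \<tau>
       then cfun_scale (of_real (word_hartley q (with_zeros c (length \<tau> - length c)) \<tau>))
         (indicator {length \<tau> - length c})
       else 0) n"
    by (cases "length c + n = length \<tau>") (auto simp: cfun_scale_def indicator_def)
  finally show "stem_coordinate q c (indicator {\<tau>}) n = \<dots>" .
qed

context
  fixes q :: nat and f :: "complex \<Rightarrow> complex"
  assumes q: "2 \<le> q" and f: "f \<in> Linf_circle"
begin

interpretation tree: infinite_ell2_decomposition "tree q" "tree_stems q" "UNIV :: nat set" "stem_coordinate q"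
  by (rule infinite_ell2_decomposition_tree[OF q])

private lemma q0: "0 < q"
  using q by simp

private abbreviation "A \<equiv> tree.ampliation (toeplitz_operator f)"

private lemma hartley_transform_column:
  assumes c: "c \<in> tree_stems q" and \<tau>: "\<tau> \<in> tree q"
  shows "hartley_transform q (A (indicator {\<tau>})) (with_zeros c n) =
    (if length c \<le> length \<tau>
     then of_real (word_hartley q (with_zeros c (length \<tau> - length c)) \<tau>) *
       fourier_coeff f (int n - int (length \<tau> - length c))
     else 0)"
proof -
  note T = toeplitz_operator[OF f]
  have "hartley_transform q (A (indicator {\<tau>})) (with_zeros c n) =
      stem_coordinate q c (A (indicator {\<tau>})) n"
    by (simp add: stem_coordinate_def)
  also have "\<dots> = toeplitz_operator f (stem_coordinate q c (indicator {\<tau>})) n"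
    by (simp only: tree.P_ampliation[OF T(1) c indicator_ell2[OF \<tau>]])
  also have "toeplitz_operator f (stem_coordinate q c (indicator {\<tau>})) =
    (if length c \<le> length \<tau>
     then cfun_scale (of_real (word_hartley q (with_zeros c (length \<tau> - length c)) \<tau>))
       (toeplitz_operator f (indicator {length \<tau> - length c}))
     else 0)"
    unfolding stem_coordinate_indicator[OF q0 c \<tau>]
    by (simp only: bounded_operatorD(3)[OF T(1) indicator_ell2[OF UNIV_I]] bounded_operator_zero[OF T(1)]
        if_distrib[of "toeplitz_operator f"])
  finally show ?thesis
    by (simp add: cfun_scale_def T(2))
qed

private lemma column_eq_sum:
  assumes \<sigma>: "\<sigma> \<in> tree q" and \<tau>: "\<tau> \<in> tree q"
  shows "A (indicator {\<tau>}) \<sigma> = (\<Sum>a\<in>tree_words q (length \<sigma>).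
    of_real (word_hartley q \<sigma> a) * hartley_transform q (A (indicator {\<tau>})) a)"
proof -
  have "A (indicator {\<tau>}) \<in> ell2 (tree q)"
    by (intro bounded_operatorD(1)[OF tree.bounded_ampliation] toeplitz_operator(1)[OF f] indicator_ell2 \<tau>)
  then have "A (indicator {\<tau>}) \<sigma> = hartley_transform q (hartley_transform q (A (indicator {\<tau>}))) \<sigma>"
    by (simp only: hartley_transform_ell2_involution)
  then show ?thesis
    using \<sigma> by (simp add: hartley_transform_def[of q "hartley_transform q _"])
qed

text \<open>
  Only the first letters of the longer word take part in the orthogonality relation; each of the
  remaining letters is paired with the label \<open>0\<close> and contributes a factor \<open>1 / sqrt q\<close>.
\<close>

private lemma column_below:
  assumes \<sigma>: "\<sigma> \<in> tree q" and \<tau>: "\<tau> @ \<rho> \<in> tree q" and len: "length \<sigma> = length \<tau>"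
  shows "A (indicator {\<tau> @ \<rho>}) \<sigma> =
    (if \<sigma> = \<tau> then of_real ((1 / sqrt q) ^ length \<rho>) * fourier_coeff f (- int (length \<rho>)) else 0)"
proof -
  define W where "W = tree_words q (length \<sigma>)"
  have mem: "\<sigma> \<in> W" "\<tau> \<in> W"
    using \<sigma> \<tau> len by (auto simp: W_def tree_words_def tree_append_iff)
  define x where "x = of_real ((1 / sqrt q) ^ length \<rho>) * fourier_coeff f (- int (length \<rho>))"
  have "hartley_transform q (A (indicator {\<tau> @ \<rho>})) a = of_real (word_hartley q a \<tau>) * x" if "a \<in> W" for a
  proof -
    have a: "a \<in> tree q" "length a = length \<tau>"
      using that len by (auto simp: W_def tree_words_def)
    obtain c n where c: "c \<in> tree_stems q" "a = with_zeros c n"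
      using a(1) by (rule with_zeros_cases)
    have l: "length c + n = length \<tau>"
      using a(2) c(2) by (simp add: with_zeros_def)
    then have d: "length (\<tau> @ \<rho>) - length c = n + length \<rho>"
      by simp
    have "with_zeros c (n + length \<rho>) = a @ replicate (length \<rho>) 0"
      by (simp add: with_zeros_def c(2) replicate_add)
    then have "word_hartley q (with_zeros c (n + length \<rho>)) (\<tau> @ \<rho>) =
        word_hartley q a \<tau> * (1 / sqrt q) ^ length \<rho>"
      using word_hartley_replicate_0[of q \<rho>] a(2)
      by (simp add: word_hartley_append word_hartley_sym[of q "replicate _ _"])
    then show ?thesis
      unfolding c(2) hartley_transform_column[OF c(1) \<tau>] d using l by (simp add: x_def c(2))
  qed
  then have "A (indicator {\<tau> @ \<rho>}) \<sigma> =
      (\<Sum>a\<in>W. of_real (word_hartley q \<sigma> a) * (of_real (word_hartley q a \<tau>) * x))"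
    unfolding column_eq_sum[OF \<sigma> \<tau>] W_def[symmetric] by (intro sum.cong) auto
  also have "\<dots> = of_real (\<Sum>a\<in>W. word_hartley q \<sigma> a * word_hartley q a \<tau>) * x"
    unfolding of_real_sum sum_distrib_right by (intro sum.cong refl) simp
  also have "\<dots> = (if \<sigma> = \<tau> then x else 0)"
    using mem unfolding W_def by (simp add: word_hartley_orthogonal)
  finally show ?thesis
    by (simp add: x_def)
qed

private lemma column_above:
  assumes \<sigma>: "\<sigma> @ \<rho> \<in> tree q" and \<tau>: "\<tau> \<in> tree q" and len: "length \<sigma> = length \<tau>"
  shows "A (indicator {\<tau>}) (\<sigma> @ \<rho>) =
    (if \<sigma> = \<tau> then of_real ((1 / sqrt q) ^ length \<rho>) * fourier_coeff f (int (length \<rho>)) else 0)"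
proof -
  define W where "W = tree_words q (length \<sigma>)"
  define k where "k = length \<rho>"
  define append_zeros :: "nat list \<Rightarrow> nat list" where "append_zeros b = b @ replicate k 0" for b
  define V where "V = tree_words q (length (\<sigma> @ \<rho>))"
  have mem: "\<sigma> \<in> W" "\<tau> \<in> W"
    using \<sigma> \<tau> len by (auto simp: W_def tree_words_def tree_append_iff)
  have sub: "append_zeros ` W \<subseteq> V"
    using replicate_0_in_tree[OF q0]
    by (auto simp: W_def V_def append_zeros_def tree_words_def tree_append_iff k_def)
  have inj: "inj_on append_zeros W"
    by (auto simp: inj_on_def append_zeros_def)
  have append_zeros_value: "hartley_transform q (A (indicator {\<tau>})) (append_zeros b) =
      of_real (word_hartley q b \<tau>) * fourier_coeff f (int k)" if "b \<in> W" for b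
  proof -
    have b: "b \<in> tree q" "length b = length \<tau>"
      using that len by (auto simp: W_def tree_words_def)
    obtain c n where c: "c \<in> tree_stems q" "b = with_zeros c n"
      using b(1) by (rule with_zeros_cases)
    have l: "length c + n = length \<tau>"
      using b(2) c(2) by (simp add: with_zeros_def)
    then have d: "length \<tau> - length c = n"
      by simp
    have "append_zeros b = with_zeros c (n + k)"
      by (simp add: with_zeros_def append_zeros_def c(2) replicate_add)
    then show ?thesis
      using hartley_transform_column[OF c(1) \<tau>, of "n + k"] l unfolding d by (simp add: c(2))
  qed
  \<comment> \<open>With fewer than \<open>k\<close> trailing zeros, the orbit of \<open>a\<close> starts below the level of \<open>\<tau>\<close>.\<close>
  have zero: "hartley_transform q (A (indicator {\<tau>})) a = 0" if a: "a \<in> V - append_zeros ` W" for a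
  proof -
    have "a \<in> tree q"
      using a by (simp add: V_def tree_words_def)
    then obtain c n where c: "c \<in> tree_stems q" "a = with_zeros c n"
      by (rule with_zeros_cases)
    have l: "length c + n = length \<tau> + k"
      using a c(2) len by (simp add: V_def tree_words_def with_zeros_def k_def)
    have "\<not> length c \<le> length \<tau>"
    proof
      assume le: "length c \<le> length \<tau>"
      define b where "b = with_zeros c (n - k)"
      have "a = append_zeros b"
        using le l by (simp add: c(2) b_def append_zeros_def with_zeros_def flip: replicate_add)
      moreover have "b \<in> W"
        using le l len with_zeros_tree[OF q0 c(1), of "n - k"]
        by (simp add: W_def b_def tree_words_def with_zeros_def)
      ultimately show False
        using a by blast
    qed
    then show ?thesis
      by (simp add: c(2) hartley_transform_column[OF c(1) \<tau>])
  qed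
  define x where "x = of_real ((1 / sqrt q) ^ k) * fourier_coeff f (int k)"
  have "A (indicator {\<tau>}) (\<sigma> @ \<rho>) =
      (\<Sum>a\<in>V. of_real (word_hartley q (\<sigma> @ \<rho>) a) * hartley_transform q (A (indicator {\<tau>})) a)"
    unfolding V_def by (rule column_eq_sum[OF \<sigma> \<tau>])
  also have "\<dots> = (\<Sum>a\<in>append_zeros ` W.
      of_real (word_hartley q (\<sigma> @ \<rho>) a) * hartley_transform q (A (indicator {\<tau>})) a)"
    by (rule sum.mono_neutral_right[OF _ sub]) (simp_all add: V_def[symmetric] zero, simp add: V_def)
  also have "\<dots> = (\<Sum>b\<in>W. of_real (word_hartley q (\<sigma> @ \<rho>) (append_zeros b)) *
      hartley_transform q (A (indicator {\<tau>})) (append_zeros b))"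
    by (simp add: sum.reindex[OF inj])
  also have "\<dots> = (\<Sum>b\<in>W. of_real (word_hartley q \<sigma> b * word_hartley q b \<tau>) * x)"
  proof (rule sum.cong[OF refl])
    fix b assume b: "b \<in> W"
    then have "length \<sigma> = length b"
      by (simp add: W_def tree_words_def)
    then have "word_hartley q (\<sigma> @ \<rho>) (append_zeros b) = word_hartley q \<sigma> b * (1 / sqrt q) ^ k"
      by (simp only: append_zeros_def word_hartley_append k_def word_hartley_replicate_0)
    then show "of_real (word_hartley q (\<sigma> @ \<rho>) (append_zeros b)) *
        hartley_transform q (A (indicator {\<tau>})) (append_zeros b) =
        of_real (word_hartley q \<sigma> b * word_hartley q b \<tau>) * x"
      by (simp add: append_zeros_value[OF b] x_def mult_ac)
  qed
  also have "\<dots> = of_real (\<Sum>b\<in>W. word_hartley q \<sigma> b * word_hartley q b \<tau>) * x"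
    by (simp add: sum_distrib_right)
  also have "\<dots> = (if \<sigma> = \<tau> then x else 0)"
    using mem unfolding W_def by (simp add: word_hartley_orthogonal)
  finally show ?thesis
    by (simp add: x_def k_def)
qed

lemma tree_toeplitz_operator_eq_ampliation: "tree_toeplitz_operator q f = A"
  unfolding tree_toeplitz_operator_def
proof (rule kernel_operator_eqI)
  show "bounded_operator (tree q) A"
    by (rule tree.bounded_ampliation[OF toeplitz_operator(1)[OF f]])
  show "has_kernel (tree q) A (tree_toeplitz_kernel q f)"
    unfolding has_kernel_def
  proof (intro ballI)
    fix \<sigma> \<tau> assume \<sigma>: "\<sigma> \<in> tree q" and \<tau>: "\<tau> \<in> tree q"
    have "A (indicator {\<tau>}) \<sigma> = tree_toeplitz_kernel q f \<sigma> \<tau>"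
    proof (cases "length \<sigma> \<le> length \<tau>")
      case True
      define \<tau>' \<rho> where "\<tau>' = take (length \<sigma>) \<tau>" and "\<rho> = drop (length \<sigma>) \<tau>"
      have \<tau>_eq: "\<tau> = \<tau>' @ \<rho>" and len: "length \<sigma> = length \<tau>'"
        using True by (simp_all add: \<tau>'_def \<rho>_def)
      show ?thesis
      proof (cases "\<sigma> = \<tau>'")
        case True
        then show ?thesis
          using column_below[of \<sigma> \<tau>' \<rho>] tree_toeplitz_kernel_append(2)[OF q0, of \<sigma> \<rho> f] \<sigma> \<tau> \<tau>_eq
          by simp
      next
        case False
        then have "tree_toeplitz_kernel q f \<sigma> \<tau> = 0"
          using len by (intro tree_toeplitz_kernel_incomparable q0 \<sigma> \<tau>) (auto simp: \<tau>_eq)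
        then show ?thesis
          using column_below[of \<sigma> \<tau>' \<rho>] \<sigma> \<tau> \<tau>_eq len False by simp
      qed
    next
      case le: False
      define \<sigma>' \<rho> where "\<sigma>' = take (length \<tau>) \<sigma>" and "\<rho> = drop (length \<tau>) \<sigma>"
      have \<sigma>_eq: "\<sigma> = \<sigma>' @ \<rho>" and len: "length \<sigma>' = length \<tau>"
        using le by (simp_all add: \<sigma>'_def \<rho>_def)
      show ?thesis
      proof (cases "\<sigma>' = \<tau>")
        case True
        then show ?thesis
          using column_above[of \<sigma>' \<rho> \<tau>] tree_toeplitz_kernel_append(1)[OF q0, of \<tau> \<rho> f] \<sigma> \<tau> \<sigma>_eq
          by simp
      next
        case False
        then have "tree_toeplitz_kernel q f \<sigma> \<tau> = 0"
          using len by (intro tree_toeplitz_kernel_incomparable q0 \<sigma> \<tau>) (auto simp: \<sigma>_eq)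
        then show ?thesis
          using column_above[of \<sigma>' \<rho> \<tau>] \<sigma> \<tau> \<sigma>_eq len False by simp
      qed
    qed
    then show "ell2_inner (tree q) (A (indicator {\<tau>})) (indicator {\<sigma>}) = tree_toeplitz_kernel q f \<sigma> \<tau>"
      by (simp add: ell2_inner_indicator[OF \<sigma>])
  qed
qed

lemma fredholm_imp_toeplitz_invertible:
  "fredholm_operator (tree q) (tree_toeplitz_operator q f) \<Longrightarrow> invertible_operator UNIV (toeplitz_operator f)"
  unfolding tree_toeplitz_operator_eq_ampliation
  by (rule tree.fredholm_ampliation_imp_invertible[OF toeplitz_operator(1)[OF f]])

lemma toeplitz_invertible_imp_invertible:
  "invertible_operator UNIV (toeplitz_operator f) \<Longrightarrow> invertible_operator (tree q) (tree_toeplitz_operator q f)"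
  unfolding tree_toeplitz_operator_eq_ampliation by (rule tree.invertible_ampliation)

end

theorem corollary1p8:
  fixes q :: nat and f :: "complex \<Rightarrow> complex"
  assumes "q \<ge> 2" and "f \<in> Linf_circle"
  shows "(fredholm_operator (tree q) (tree_toeplitz_operator q f) \<longleftrightarrow>
            invertible_operator (tree q) (tree_toeplitz_operator q f)) \<and>
         (invertible_operator (tree q) (tree_toeplitz_operator q f) \<longleftrightarrow>
            invertible_operator UNIV (toeplitz_operator f))"
  using fredholm_imp_toeplitz_invertible[OF assms] toeplitz_invertible_imp_invertible[OF assms]
    invertible_imp_fredholm by blast

end
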